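(* Let $G$ be an almost unimodular locally compact second countable group with modular function $\Delta_G$, and let $\Gamma$ be a countable dense subgroup of $G$. The following are equivalent: (i) The left translation action of $\Gamma$ on $G$ is strongly ergodic. (ii) The left translation action of $\Gamma_1 := \Gamma\cap\ker\Delta_G$ on $G_1 := \ker\Delta_G$ is strongly ergodic.
   Context: A locally compact group $G$ with modular function $\Delta_G : G\to\mathbb{R}_+=(0,\infty)$ is called almost unimodular if $\ker\Delta_G$ is open in $G$. Every locally compact second countable group $K$ (here $K=G$ or $K=\ker\Delta_G$) is equipped with a probability measure $\mu_K$ equivalent to its left Haar measure. A non-singular countable Borel equivalence relation $\mathcal{R}$ on a standard probability space $(X,\mu)$ has full group $[\mathcal{R}]$, the group of (non-singular) Borel automorphisms $g$ of $X$ with $(gx,x)\in\mathcal{R}$ for almost every $x$. An almost invariant sequence for $\mathcal{R}$ is a sequence of measurable sets $A_n\subset X$ with $\mu(A_n \,\Delta\, gA_n)\to 0$ for all $g\in[\mathcal{R}]$; it is trivial if $\mu(A_n)(1-\mu(A_n))\to 0$. $\mathcal{R}$ is strongly ergodic if it has no non-trivial almost invariant sequence. A non-singular action of a countable group is strongly ergodic if its orbit equivalence relation is. *)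

theory Defs
  imports
    "HOL-Analysis.Abstract_Topological_Spaces"
    "HOL-Probability.Probability_Measure"
    "HOL-Algebra.Group_Action"
begin

definition topological_group :: "('a, 'b) monoid_scheme \<Rightarrow> 'a topology \<Rightarrow> bool" where
  "topological_group G T \<longleftrightarrow>
     group G \<and> topspace T = carrier G \<and>
     continuous_map (prod_topology T T) T (\<lambda>(x, y). x \<otimes>\<^bsub>G\<^esub> y) \<and>
     continuous_map T T (\<lambda>x. inv\<^bsub>G\<^esub> x)"

definition lcsc_group :: "('a, 'b) monoid_scheme \<Rightarrow> 'a topology \<Rightarrow> bool" where
  "lcsc_group G T \<longleftrightarrow>
     topological_group G T \<and> Hausdorff_space T \<and> locally_compact_space T \<and> second_countable T"

definition borel_on :: "'a topology \<Rightarrow> 'a measure" where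
  "borel_on T = sigma (topspace T) {U. openin T U}"

text \<open>No regularity is demanded: on a locally compact second countable Hausdorff space every Borel
  measure that is finite on compact sets is automatically a Radon measure.\<close>

definition left_haar_measure :: "('a, 'b) monoid_scheme \<Rightarrow> 'a topology \<Rightarrow> 'a measure \<Rightarrow> bool" where
  "left_haar_measure G T \<nu> \<longleftrightarrow>
     sets \<nu> = sets (borel_on T) \<and>
     emeasure \<nu> (carrier G) \<noteq> 0 \<and>
     (\<forall>K. compactin T K \<longrightarrow> emeasure \<nu> K < \<infinity>) \<and>
     (\<forall>g\<in>carrier G. \<forall>A\<in>sets \<nu>. emeasure \<nu> (g <#\<^bsub>G\<^esub> A) = emeasure \<nu> A)"

text \<open>A probability measure equivalent to (i.e. with the same null sets as) left Haar measure.\<close>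

definition haar_probability :: "('a, 'b) monoid_scheme \<Rightarrow> 'a topology \<Rightarrow> 'a measure \<Rightarrow> bool" where
  "haar_probability G T \<mu> \<longleftrightarrow>
     prob_space \<mu> \<and> sets \<mu> = sets (borel_on T) \<and>
     (\<exists>\<nu>. left_haar_measure G T \<nu> \<and> null_sets \<mu> = null_sets \<nu>)"

text \<open>The convention is \<open>\<nu>(Ag) = \<Delta>(g) \<nu>(A)\<close> for a left Haar measure \<open>\<nu>\<close>. The other common
  convention replaces \<open>\<Delta>\<close> by \<open>1/\<Delta>\<close> and has the same kernel. Uniqueness of left Haar measure up to
  scaling is what makes the factor independent of \<open>\<nu>\<close> and \<open>A\<close>.\<close>

definition modular_function :: "('a, 'b) monoid_scheme \<Rightarrow> 'a topology \<Rightarrow> 'a \<Rightarrow> real" where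
  "modular_function G T g =
     (THE c. 0 < c \<and>
        (\<forall>\<nu>. left_haar_measure G T \<nu> \<longrightarrow>
           (\<forall>A\<in>sets \<nu>. emeasure \<nu> (A #>\<^bsub>G\<^esub> g) = ennreal c * emeasure \<nu> A)))"

definition modular_kernel :: "('a, 'b) monoid_scheme \<Rightarrow> 'a topology \<Rightarrow> 'a set" where
  "modular_kernel G T = {g \<in> carrier G. modular_function G T g = 1}"

definition almost_unimodular :: "('a, 'b) monoid_scheme \<Rightarrow> 'a topology \<Rightarrow> bool" where
  "almost_unimodular G T \<longleftrightarrow> openin T (modular_kernel G T)"

definition nonsingular_automorphism :: "'a measure \<Rightarrow> ('a \<Rightarrow> 'a) \<Rightarrow> bool" where
  "nonsingular_automorphism M g \<longleftrightarrow>
     bij_betw g (space M) (space M) \<and>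
     g \<in> measurable M M \<and> inv_into (space M) g \<in> measurable M M \<and>
     (\<forall>A\<in>sets M. emeasure M (g ` A) = 0 \<longleftrightarrow> emeasure M A = 0)"

definition full_group :: "'a measure \<Rightarrow> ('a \<times> 'a) set \<Rightarrow> ('a \<Rightarrow> 'a) set" where
  "full_group M R = {g. nonsingular_automorphism M g \<and> (AE x in M. (g x, x) \<in> R)}"

definition almost_invariant_sequence ::
    "'a measure \<Rightarrow> ('a \<times> 'a) set \<Rightarrow> (nat \<Rightarrow> 'a set) \<Rightarrow> bool" where
  "almost_invariant_sequence M R A \<longleftrightarrow>
     (\<forall>n. A n \<in> sets M) \<and>
     (\<forall>g\<in>full_group M R. (\<lambda>n. measure M (sym_diff (A n) (g ` A n))) \<longlonglongrightarrow> 0)"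

definition trivial_sequence :: "'a measure \<Rightarrow> (nat \<Rightarrow> 'a set) \<Rightarrow> bool" where
  "trivial_sequence M A \<longleftrightarrow> (\<lambda>n. measure M (A n) * (1 - measure M (A n))) \<longlonglongrightarrow> 0"

definition strongly_ergodic :: "'a measure \<Rightarrow> ('a \<times> 'a) set \<Rightarrow> bool" where
  "strongly_ergodic M R \<longleftrightarrow>
     (\<forall>A. almost_invariant_sequence M R A \<longrightarrow> trivial_sequence M A)"

definition orbit_relation ::
    "('g, 'b) monoid_scheme \<Rightarrow> ('g \<Rightarrow> 'a \<Rightarrow> 'a) \<Rightarrow> 'a set \<Rightarrow> ('a \<times> 'a) set" where
  "orbit_relation \<Gamma> \<phi> X = {(x, y). x \<in> X \<and> y \<in> orbit \<Gamma> \<phi> x}"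

definition strongly_ergodic_action ::
    "('g, 'b) monoid_scheme \<Rightarrow> ('g \<Rightarrow> 'a \<Rightarrow> 'a) \<Rightarrow> 'a measure \<Rightarrow> bool" where
  "strongly_ergodic_action \<Gamma> \<phi> M \<longleftrightarrow> strongly_ergodic M (orbit_relation \<Gamma> \<phi> (space M))"

text \<open>Restricted to the carrier, as the library's \<^const>\<open>group_action\<close> requires.\<close>

definition left_translation :: "('a, 'b) monoid_scheme \<Rightarrow> 'a \<Rightarrow> 'a \<Rightarrow> 'a" where
  "left_translation G g = (\<lambda>x\<in>carrier G. g \<otimes>\<^bsub>G\<^esub> x)"

end

theory Submission
  imports Defs
begin

text \<open>
  Only the fact that \<open>H = ker \<Delta>\<close> is an open subgroup matters. Since \<open>\<Gamma>\<close> is dense, \<open>G\<close> is the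
  disjoint union of countably many cosets \<open>s H\<close> with \<open>s \<in> \<Gamma>\<close>, so the action of \<open>\<Gamma>\<close> on \<open>G\<close> is induced
  from the action of \<open>\<Gamma> \<inter> H\<close> on \<open>H\<close>. An almost \<open>\<Gamma> \<inter> H\<close>-invariant sequence \<open>A\<^sub>n\<close> in \<open>H\<close> extends to
  the almost \<open>\<Gamma>\<close>-invariant sequence \<open>\<Union>s. s A\<^sub>n\<close>, and conversely an almost \<open>\<Gamma>\<close>-invariant
  sequence is determined asymptotically by its trace on \<open>H\<close>; triviality passes both ways. For the
  full group, almost invariance under \<open>\<Gamma>\<close> suffices, because an element of the full group agrees
  with a translation by an element of \<open>\<Gamma>\<close> on each piece of a countable partition.

  Uniqueness of left Haar measure up to scaling is needed to know that the modular function is well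
  defined (so that its kernel is a subgroup), and that the measure class on \<open>H\<close> is the
  restriction of the one on \<open>G\<close>.
\<close>

section \<open>Measures and Borel sets\<close>

text \<open>By continuity from above, finitely many pieces already carry all but
  \<open>e / 2\<close> of the mass, and over finitely many pieces the limits may be summed. The
  pieces may overlap. This serves both the pieces on which a full group element is a translation and
  the cosets of \<open>H\<close>.\<close>

lemma tendsto_measure_cover:
  assumes "finite_measure M"
    and D: "\<And>n. D n \<in> sets M" and P: "\<And>k. P k \<in> sets M"
    and cover: "AE x in M. \<exists>k::nat. x \<in> P k"
    and lim: "\<And>k. (\<lambda>n. measure M (D n \<inter> P k)) \<longlonglongrightarrow> 0"
  shows "(\<lambda>n::nat. measure M (D n)) \<longlonglongrightarrow> 0"
proof -
  interpret finite_measure M by fact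
  define R where "R K = space M - (\<Union>k<K. P k)" for K :: nat
  have R: "R K \<in> sets M" for K using P by (auto simp: R_def)
  have "(\<Inter>K. R K) = {x \<in> space M. \<not> (\<exists>k. x \<in> P k)}" by (auto simp: R_def)
  moreover have "emeasure M {x \<in> space M. \<not> (\<exists>k. x \<in> P k)} = 0"
    using cover P by (subst (asm) AE_iff_measurable[OF _ refl]) auto
  ultimately have "measure M (\<Inter>K. R K) = 0"
    by (simp add: measure_def)
  moreover have "(\<lambda>K. measure M (R K)) \<longlonglongrightarrow> measure M (\<Inter>K. R K)"
    by (intro finite_Lim_measure_decseq) (use R in \<open>auto simp: decseq_def R_def\<close>)
  ultimately have R0: "(\<lambda>K. measure M (R K)) \<longlonglongrightarrow> 0" by simp
  show ?thesis
  proof (rule LIMSEQ_I, simp)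
    fix e :: real assume "0 < e"
    then obtain K where K: "measure M (R K) < e / 2"
      using order_tendstoD(2)[OF R0, of "e/2"] by (auto simp: eventually_sequentially)
    have "(\<lambda>n. \<Sum>k<K. measure M (D n \<inter> P k)) \<longlonglongrightarrow> (\<Sum>k<K. 0)"
      by (intro tendsto_sum lim)
    then have "\<forall>\<^sub>F n in sequentially. (\<Sum>k<K. measure M (D n \<inter> P k)) < e / 2"
      using \<open>0 < e\<close> by (intro order_tendstoD) auto
    then obtain N where N: "\<And>n. n \<ge> N \<Longrightarrow> (\<Sum>k<K. measure M (D n \<inter> P k)) < e / 2"
      by (auto simp: eventually_sequentially)
    have "measure M (D n) < e" if "n \<ge> N" for n
    proof -
      have "measure M (D n) \<le> measure M ((\<Union>k<K. D n \<inter> P k) \<union> R K)"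
        by (rule finite_measure_mono)
          (use D P R sets.sets_into_space[OF D] in \<open>auto simp: R_def subset_iff\<close>)
      also have "\<dots> \<le> measure M (\<Union>k<K. D n \<inter> P k) + measure M (R K)"
        by (rule measure_Un_le) (use D P R in auto)
      also have "measure M (\<Union>k<K. D n \<inter> P k) \<le> (\<Sum>k<K. measure M (D n \<inter> P k))"
        by (rule finite_measure_subadditive_finite) (use D P in auto)
      finally show ?thesis using N[OF that] K by simp
    qed
    then show "\<exists>no. \<forall>n\<ge>no. measure M (D n) < e" by blast
  qed
qed

text \<open>Otherwise some sequence has summable \<open>M\<close>-measures and
  \<open>N\<close>-measures at least \<open>e\<close>. By Borel-Cantelli its limsup is
  \<open>M\<close>-null, hence \<open>N\<close>-null, while continuity from above gives it
  \<open>N\<close>-measure at least \<open>e\<close>. Consequently only the measure class matters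
  for convergence to 0.\<close>

lemma tendsto_measure_absolutely_continuous:
  fixes A :: "nat \<Rightarrow> 'a set"
  assumes "finite_measure M" "finite_measure N"
    and sets: "sets N = sets M" and ac: "null_sets M \<subseteq> null_sets N"
    and A: "\<And>n. A n \<in> sets M"
    and lim: "(\<lambda>n. measure M (A n)) \<longlonglongrightarrow> 0"
  shows "(\<lambda>n. measure N (A n)) \<longlonglongrightarrow> 0"
proof (rule ccontr)
  interpret M: finite_measure M by fact
  interpret N: finite_measure N by fact
  assume "\<not> ?thesis"
  then obtain e where e: "e > 0" "\<And>k. \<exists>n\<ge>k. e \<le> measure N (A n)"
    by (force simp: LIMSEQ_iff not_less)
  \<comment> \<open>The geometric bound makes the measures summable; the indices \<open>r k\<close>
    chosen from it need not increase.\<close>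
  have "\<exists>n. e \<le> measure N (A n) \<and> measure M (A n) \<le> (1/2)^k" for k
  proof -
    have "\<forall>\<^sub>F n in sequentially. measure M (A n) < (1/2)^k"
      using lim by (rule order_tendstoD) simp
    then obtain m where "\<And>n. n \<ge> m \<Longrightarrow> measure M (A n) < (1/2)^k"
      by (auto simp: eventually_sequentially)
    with e(2)[of m] show ?thesis by (meson less_imp_le)
  qed
  then obtain r where r: "\<And>k. e \<le> measure N (A (r k))" "\<And>k. measure M (A (r k)) \<le> (1/2)^k"
    by metis
  define U where "U n = (\<Union>k\<in>{n..}. A (r k))" for n
  have "limsup (\<lambda>k. A (r k)) \<in> null_sets M"
  proof (rule borel_cantelli_limsup1)
    show "summable (\<lambda>k. measure M (A (r k)))"
      by (rule summable_comparison_test'[of "\<lambda>k. (1/2)^k" 0]) (use r in \<open>auto simp: summable_geometric\<close>)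
  qed (use A in \<open>auto simp: M.emeasure_finite less_top[symmetric]\<close>)
  moreover have "limsup (\<lambda>k. A (r k)) = (\<Inter>n. U n)"
    by (simp add: limsup_INF_SUP U_def)
  ultimately have "measure N (\<Inter>n. U n) = 0"
    using ac by (auto simp: null_sets_def measure_def)
  moreover have "(\<lambda>n. measure N (U n)) \<longlonglongrightarrow> measure N (\<Inter>n. U n)"
    by (intro N.finite_Lim_measure_decseq) (use A sets in \<open>fastforce simp: decseq_def U_def\<close>)+
  moreover have "e \<le> measure N (U n)" for n
    by (rule order_trans[OF r(1)[of n]], rule N.finite_measure_mono) (use A sets in \<open>auto simp: U_def\<close>)
  ultimately have "e \<le> 0"
    by (metis LIMSEQ_le_const)
  with e show False by simp
qed

section \<open>Borel sets of a topology and of a product\<close>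

lemma space_borel_on [simp]: "space (borel_on T) = topspace T"
  by (simp add: borel_on_def space_measure_of_conv)

lemma sets_borel_on: "sets (borel_on T) = sigma_sets (topspace T) {U. openin T U}"
  unfolding borel_on_def by (rule sets_measure_of) (auto dest: openin_subset)

lemma openin_imp_borel_on: "openin T U \<Longrightarrow> U \<in> sets (borel_on T)"
  by (auto simp: sets_borel_on)

lemma closedin_imp_borel_on: "closedin T C \<Longrightarrow> C \<in> sets (borel_on T)"
proof -
  assume "closedin T C"
  then have "C = space (borel_on T) - (topspace T - C)" "openin T (topspace T - C)"
    by (auto simp: closedin_def)
  then show ?thesis by (metis sets.compl_sets openin_imp_borel_on)
qed

lemma measurable_borel_onI:
  assumes "f \<in> space M \<rightarrow> topspace T" "\<And>U. openin T U \<Longrightarrow> {x \<in> space M. f x \<in> U} \<in> sets M"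
  shows "f \<in> measurable M (borel_on T)"
  by (rule measurable_sigma_sets[OF sets_borel_on])
    (use assms in \<open>auto dest: openin_subset simp: vimage_def Int_def conj_commute\<close>)

lemma continuous_map_imp_measurable:
  "continuous_map S T f \<Longrightarrow> f \<in> measurable (borel_on S) (borel_on T)"
  by (rule measurable_borel_onI)
    (auto simp: continuous_map_def Pi_iff intro!: openin_imp_borel_on)

text \<open>Countable bases turn \<open>W\<close> into a countable union of open rectangles. This
  makes the group multiplication measurable for the product sigma-algebra, as Fubini
  requires.\<close>

lemma openin_prod_imp_measurable:
  assumes "second_countable S" "second_countable T" "openin (prod_topology S T) W"
  shows "W \<in> sets (borel_on S \<Otimes>\<^sub>M borel_on T)"
proof -
  obtain \<B> where \<B>: "countable \<B>" "\<And>V. V \<in> \<B> \<Longrightarrow> openin S V"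
    "\<And>U x. openin S U \<Longrightarrow> x \<in> U \<Longrightarrow> \<exists>V\<in>\<B>. x \<in> V \<and> V \<subseteq> U"
    using assms(1) unfolding second_countable_def by metis
  obtain \<C> where \<C>: "countable \<C>" "\<And>V. V \<in> \<C> \<Longrightarrow> openin T V"
    "\<And>U x. openin T U \<Longrightarrow> x \<in> U \<Longrightarrow> \<exists>V\<in>\<C>. x \<in> V \<and> V \<subseteq> U"
    using assms(2) unfolding second_countable_def by metis
  define I where "I = {p \<in> \<B> \<times> \<C>. fst p \<times> snd p \<subseteq> W}"
  have "W = (\<Union>p\<in>I. fst p \<times> snd p)"
  proof (intro equalityI subsetI)
    fix z assume "z \<in> W"
    then obtain x y U V where "z = (x, y)" "openin S U" "openin T V" "x \<in> U" "y \<in> V" "U \<times> V \<subseteq> W"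
      using assms(3) unfolding openin_prod_topology_alt by (metis surj_pair)
    moreover obtain b c where "b \<in> \<B>" "x \<in> b" "b \<subseteq> U" "c \<in> \<C>" "y \<in> c" "c \<subseteq> V"
      using \<B>(3) \<C>(3) calculation by meson
    ultimately show "z \<in> (\<Union>p\<in>I. fst p \<times> snd p)"
      by (intro UN_I[of "(b, c)"]) (auto simp: I_def)
  qed (auto simp: I_def)
  also have "\<dots> \<in> sets (borel_on S \<Otimes>\<^sub>M borel_on T)"
    using \<B>(1,2) \<C>(1,2)
    by (intro sets.countable_UN'' countable_subset[OF _ countable_SIGMA[of \<B> "\<lambda>_. \<C>"]] pair_measureI openin_imp_borel_on)
      (auto simp: I_def)
  finally show ?thesis .
qed

lemma continuous_map_prod_imp_measurable:
  assumes "second_countable S" "second_countable T" "continuous_map (prod_topology S T) Z f"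
  shows "f \<in> measurable (borel_on S \<Otimes>\<^sub>M borel_on T) (borel_on Z)"
proof (rule measurable_borel_onI)
  show "f \<in> space (borel_on S \<Otimes>\<^sub>M borel_on T) \<rightarrow> topspace Z"
    using assms(3) by (auto simp: continuous_map_def space_pair_measure)
  fix U assume "openin Z U"
  with assms(3) have "openin (prod_topology S T) {x \<in> topspace (prod_topology S T). f x \<in> U}"
    by (simp only: continuous_map_def)
  then show "{x \<in> space (borel_on S \<Otimes>\<^sub>M borel_on T). f x \<in> U} \<in> sets (borel_on S \<Otimes>\<^sub>M borel_on T)"
    using openin_prod_imp_measurable[OF assms(1,2)] by (simp add: space_pair_measure)
qed

section \<open>Left Haar measure and the modular kernel\<close>

no_notation subset_mset (infix \<open><#\<close> 50)

text \<open>In this form a coset is a preimage under a translation, so it inherits measurability and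
  openness from \<open>A\<close>.\<close>

lemma (in group) l_coset_eq:
  assumes "A \<subseteq> carrier G" "g \<in> carrier G"
  shows "g <# A = {x \<in> carrier G. inv g \<otimes> x \<in> A}"
proof (intro equalityI subsetI)
  fix x assume "x \<in> {x \<in> carrier G. inv g \<otimes> x \<in> A}"
  then show "x \<in> g <# A"
    using assms by (auto simp: l_coset_def m_assoc[symmetric] intro!: bexI[of _ "inv g \<otimes> x"])
qed (use assms in \<open>auto simp: l_coset_def m_assoc[symmetric] subset_iff\<close>)

lemma (in group) r_coset_eq:
  assumes "A \<subseteq> carrier G" "g \<in> carrier G"
  shows "A #> g = {x \<in> carrier G. x \<otimes> inv g \<in> A}"
proof (intro equalityI subsetI)
  fix x assume "x \<in> {x \<in> carrier G. x \<otimes> inv g \<in> A}"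
  then show "x \<in> A #> g"
    using assms by (auto simp: r_coset_def m_assoc intro!: bexI[of _ "x \<otimes> inv g"])
qed (use assms in \<open>auto simp: r_coset_def m_assoc subset_iff\<close>)

section \<open>Translations in a locally compact second countable group\<close>

locale lcsc_topological_group = group G for G :: "('a, 'b) monoid_scheme" (structure) +
  fixes T :: "'a topology"
  assumes lcsc: "lcsc_group G T"
begin

abbreviation B where "B \<equiv> borel_on T"

lemma
  shows topspace_eq [simp]: "topspace T = carrier G"
    and continuous_mult: "continuous_map (prod_topology T T) T (\<lambda>(x, y). x \<otimes> y)"
    and continuous_inv: "continuous_map T T (\<lambda>x. inv x)"
    and Hausdorff: "Hausdorff_space T"
    and locally_compact: "locally_compact_space T"
    and second_countable: "second_countable T"
  using lcsc by (auto simp: lcsc_group_def topological_group_def)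

lemma borel_subset: "A \<in> sets B \<Longrightarrow> A \<subseteq> carrier G"
  using sets.sets_into_space[of A B] by simp

lemma continuous_left: "g \<in> carrier G \<Longrightarrow> continuous_map T T (\<lambda>x. g \<otimes> x)"
  using continuous_map_compose[OF _ continuous_mult, of T "\<lambda>x. (g, x)"]
  by (simp add: continuous_map_pairwise o_def)

lemma continuous_right: "g \<in> carrier G \<Longrightarrow> continuous_map T T (\<lambda>x. x \<otimes> g)"
  using continuous_map_compose[OF _ continuous_mult, of T "\<lambda>x. (x, g)"]
  by (simp add: continuous_map_pairwise o_def)

lemma measurable_mult: "(\<lambda>p. fst p \<otimes> snd p) \<in> measurable (B \<Otimes>\<^sub>M B) B"
  using continuous_map_prod_imp_measurable[OF second_countable second_countable continuous_mult]
  by (simp add: case_prod_unfold)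

lemma measurable_mult' [measurable (raw)]:
  assumes "f \<in> measurable M B" "h \<in> measurable M B"
  shows "(\<lambda>x. f x \<otimes> h x) \<in> measurable M B"
  using measurable_compose[OF measurable_Pair[OF assms] measurable_mult] by simp

lemma measurable_inv' [measurable (raw)]:
  assumes "f \<in> measurable M B"
  shows "(\<lambda>x. inv (f x)) \<in> measurable M B"
  using measurable_compose[OF assms continuous_map_imp_measurable[OF continuous_inv]] .

lemma measurable_left [measurable]: "g \<in> carrier G \<Longrightarrow> (\<lambda>x. g \<otimes> x) \<in> measurable B B"
  by measurable

lemma measurable_right [measurable]: "g \<in> carrier G \<Longrightarrow> (\<lambda>x. x \<otimes> g) \<in> measurable B B"
  by measurable

lemma l_coset_borel:
  assumes "A \<in> sets B" "g \<in> carrier G" shows "g <# A \<in> sets B"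
  using measurable_sets[OF measurable_left[of "inv g"] assms(1)] assms
  by (simp add: l_coset_eq borel_subset vimage_def Int_def conj_commute)

lemma r_coset_borel:
  assumes "A \<in> sets B" "g \<in> carrier G" shows "A #> g \<in> sets B"
  using measurable_sets[OF measurable_right[of "inv g"] assms(1)] assms
  by (simp add: r_coset_eq borel_subset vimage_def Int_def conj_commute)

lemma openin_l_coset:
  assumes "openin T U" "g \<in> carrier G" shows "openin T (g <# U)"
  using openin_continuous_map_preimage[OF continuous_left[of "inv g"] assms(1)] assms openin_subset[OF assms(1)]
  by (simp add: l_coset_eq)

lemma openin_r_coset:
  assumes "openin T U" "g \<in> carrier G" shows "openin T (U #> g)"
  using openin_continuous_map_preimage[OF continuous_right[of "inv g"] assms(1)] assms openin_subset[OF assms(1)]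
  by (simp add: r_coset_eq)

lemma compactin_r_coset:
  assumes "compactin T K" "g \<in> carrier G" shows "compactin T (K #> g)"
proof -
  have "K #> g = (\<lambda>x. x \<otimes> g) ` K" by (auto simp: r_coset_def)
  then show ?thesis using image_compactin[OF assms(1) continuous_right[OF assms(2)]] by simp
qed

lemma compactin_borel: "compactin T K \<Longrightarrow> K \<in> sets B"
  by (simp add: Hausdorff compactin_imp_closedin closedin_imp_borel_on)

end

section \<open>Left Haar measures and their uniqueness\<close>

locale left_haar = lcsc_topological_group G T for G :: "('a, 'b) monoid_scheme" (structure) and T +
  fixes \<nu> :: "'a measure"
  assumes haar: "left_haar_measure G T \<nu>"
begin

lemma sets_eq [measurable_cong, simp]: "sets \<nu> = sets B"
  using haar by (simp add: left_haar_measure_def)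

lemma space_eq [simp]: "space \<nu> = carrier G"
  using sets_eq_imp_space_eq[OF sets_eq] by simp

lemma nontrivial: "emeasure \<nu> (carrier G) \<noteq> 0"
  using haar by (simp add: left_haar_measure_def)

lemma compact_finite: "compactin T K \<Longrightarrow> emeasure \<nu> K < \<infinity>"
  using haar by (simp add: left_haar_measure_def)

lemma left_invariant: "g \<in> carrier G \<Longrightarrow> A \<in> sets B \<Longrightarrow> emeasure \<nu> (g <# A) = emeasure \<nu> A"
  using haar by (simp add: left_haar_measure_def)

text \<open>By local compactness, the basic open sets contained in compact sets cover the group, and
  each of them has finite measure.\<close>

lemma sigma_finite: "sigma_finite_measure \<nu>"
proof
  obtain \<B> where \<B>: "countable \<B>" "\<And>V. V \<in> \<B> \<Longrightarrow> openin T V"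
    "\<And>U x. openin T U \<Longrightarrow> x \<in> U \<Longrightarrow> \<exists>V\<in>\<B>. x \<in> V \<and> V \<subseteq> U"
    using second_countable unfolding second_countable_def by metis
  define A where "A = {V \<in> \<B>. \<exists>K. compactin T K \<and> V \<subseteq> K}"
  have "x \<in> \<Union>A" if x: "x \<in> carrier G" for x
  proof -
    obtain U K where "openin T U" "compactin T K" "x \<in> U" "U \<subseteq> K"
      using locally_compact x unfolding locally_compact_space_def topspace_eq by meson
    then show ?thesis using \<B>(3)[of U x] unfolding A_def by blast
  qed
  moreover have "emeasure \<nu> V \<noteq> \<infinity>" if V: "V \<in> A" for V
  proof -
    obtain K where K: "compactin T K" "V \<subseteq> K" using V by (auto simp: A_def)
    then have "emeasure \<nu> V \<le> emeasure \<nu> K"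
      by (intro emeasure_mono) (auto simp: compactin_borel)
    with compact_finite[OF K(1)] show ?thesis by (auto simp: top_unique)
  qed
  moreover have "\<Union>A \<subseteq> carrier G"
    using openin_subset[OF \<B>(2)] by (fastforce simp: A_def)
  ultimately have "\<Union>A = carrier G" "\<And>V. V \<in> A \<Longrightarrow> emeasure \<nu> V \<noteq> \<infinity>"
    by blast+
  then show "\<exists>A. countable A \<and> A \<subseteq> sets \<nu> \<and> \<Union> A = space \<nu> \<and> (\<forall>a\<in>A. emeasure \<nu> a \<noteq> \<infinity>)"
    using \<B>(1,2) by (intro exI[of _ A])
      (auto simp: A_def intro: openin_imp_borel_on countable_subset[of _ \<B>])
qed

text \<open>If \<open>U\<close> were null, so would be all its left translates. They cover the
  group, and second countability extracts a countable cover by null sets, contradicting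
  \<open>nontrivial\<close>.\<close>

lemma open_pos:
  assumes "openin T U" "U \<noteq> {}" shows "emeasure \<nu> U > 0"
proof (rule ccontr)
  assume "\<not> emeasure \<nu> U > 0"
  then have 0: "emeasure \<nu> U = 0" by simp
  obtain \<B> where \<B>: "countable \<B>" "\<And>V. V \<in> \<B> \<Longrightarrow> openin T V"
    "\<And>U x. openin T U \<Longrightarrow> x \<in> U \<Longrightarrow> \<exists>V\<in>\<B>. x \<in> V \<and> V \<subseteq> U"
    using second_countable unfolding second_countable_def by metis
  \<comment> \<open>The countable cover consists of basic open sets, each inside some translate, so
    no countable family of translates has to be selected.\<close>
  define A where "A = {V \<in> \<B>. \<exists>g\<in>carrier G. V \<subseteq> g <# U}"
  have U: "U \<subseteq> carrier G" using openin_subset[OF assms(1)] by simp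
  obtain u where u: "u \<in> U" using assms(2) by blast
  have "x \<in> \<Union>A" if x: "x \<in> carrier G" for x
  proof -
    have "x \<in> (x \<otimes> inv u) <# U"
      using u U x by (auto simp: l_coset_def m_assoc subset_iff intro!: bexI[of _ u])
    moreover have "openin T ((x \<otimes> inv u) <# U)"
      using u U x by (intro openin_l_coset assms) auto
    ultimately obtain V where "V \<in> \<B>" "x \<in> V" "V \<subseteq> (x \<otimes> inv u) <# U" using \<B>(3) by blast
    moreover have "x \<otimes> inv u \<in> carrier G" using u U x by auto
    ultimately show ?thesis unfolding A_def by blast
  qed
  then have "carrier G \<subseteq> \<Union>A" by blast
  moreover have "\<Union>A \<in> null_sets \<nu>"
  proof (rule null_sets_UN'[of A "\<lambda>V. V", simplified])
    show "countable A" using \<B>(1) by (auto simp: A_def intro: countable_subset)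
    fix V assume "V \<in> A"
    then obtain g where g: "g \<in> carrier G" "V \<subseteq> g <# U" "V \<in> \<B>" by (auto simp: A_def)
    have "g <# U \<in> null_sets \<nu>"
      using g left_invariant[of g U] assms(1) 0 by (auto simp: l_coset_borel openin_imp_borel_on)
    then show "V \<in> null_sets \<nu>"
      using g \<B>(2) by (metis null_sets_subset sets_eq openin_imp_borel_on)
  qed
  ultimately have "carrier G \<in> null_sets \<nu>"
    using sets.top[of \<nu>] by (metis null_sets_subset space_eq)
  with nontrivial show False by auto
qed

lemma nn_integral_left:
  assumes g: "g \<in> carrier G" and f: "f \<in> borel_measurable B"
  shows "(\<integral>\<^sup>+ x. f (g \<otimes> x) \<partial>\<nu>) = (\<integral>\<^sup>+ x. f x \<partial>\<nu>)"
proof -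
  have "distr \<nu> B (\<lambda>x. g \<otimes> x) = \<nu>"
  proof (rule measure_eqI)
    fix A assume "A \<in> sets (distr \<nu> B (\<lambda>x. g \<otimes> x))"
    then have A: "A \<in> sets B" by simp
    have "emeasure (distr \<nu> B (\<lambda>x. g \<otimes> x)) A = emeasure \<nu> {x \<in> carrier G. g \<otimes> x \<in> A}"
      using A g by (subst emeasure_distr) (auto intro!: arg_cong[of _ _ "emeasure \<nu>"])
    also have "{x \<in> carrier G. g \<otimes> x \<in> A} = inv g <# A"
      using A g by (simp add: l_coset_eq borel_subset)
    finally show "emeasure (distr \<nu> B (\<lambda>x. g \<otimes> x)) A = emeasure \<nu> A"
      using left_invariant[of "inv g" A] A g by simp
  qed simp
  then have "(\<integral>\<^sup>+ x. f x \<partial>\<nu>) = (\<integral>\<^sup>+ x. f x \<partial>distr \<nu> B (\<lambda>x. g \<otimes> x))" by simp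
  also have "\<dots> = (\<integral>\<^sup>+ x. f (g \<otimes> x) \<partial>\<nu>)"
    using f g by (intro nn_integral_distr) auto
  finally show ?thesis by simp
qed

text \<open>Left and right translations commute, so right translation preserves left invariance.
  Pushing forward along \<open>inv g\<close> is what gives \<open>A\<close> the mass of
  \<open>A #> g\<close>.\<close>

lemma right_translate_haar:
  assumes g: "g \<in> carrier G"
  shows "left_haar_measure G T (distr \<nu> B (\<lambda>x. x \<otimes> inv g))"
    and "A \<in> sets B \<Longrightarrow> emeasure (distr \<nu> B (\<lambda>x. x \<otimes> inv g)) A = emeasure \<nu> (A #> g)"
proof -
  show *: "emeasure (distr \<nu> B (\<lambda>x. x \<otimes> inv g)) A = emeasure \<nu> (A #> g)" if A: "A \<in> sets B" for A
    using A g by (subst emeasure_distr)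
      (auto simp: r_coset_eq borel_subset intro!: arg_cong[of _ _ "emeasure \<nu>"])
  have "carrier G #> g = carrier G"
    using g by (auto simp: r_coset_eq)
  moreover have "(h <# A) #> g = h <# (A #> g)" if "h \<in> carrier G" "A \<in> sets B" for h A
    using that g borel_subset[of A] by (auto simp: r_coset_def l_coset_def m_assoc subset_iff)
  moreover have "carrier G \<in> sets B" using sets.top[of B] by simp
  ultimately show "left_haar_measure G T (distr \<nu> B (\<lambda>x. x \<otimes> inv g))"
    using g nontrivial unfolding left_haar_measure_def
    by (auto simp: * compactin_borel compact_finite[simplified] compactin_r_coset l_coset_borel r_coset_borel left_invariant)
qed

text \<open>These bounds make \<open>emeasure \<nu> (E #> y)\<close> a legitimate divisor in the
  uniqueness argument.\<close>

lemma r_coset_pos_finite: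
  assumes "openin T E" "E \<noteq> {}" "compactin T K" "E \<subseteq> K" "y \<in> carrier G"
  shows "emeasure \<nu> (E #> y) \<noteq> 0" "emeasure \<nu> (E #> y) \<noteq> \<infinity>"
proof -
  show "emeasure \<nu> (E #> y) \<noteq> 0"
    using open_pos[OF openin_r_coset[OF assms(1,5)]] assms(2) by (auto simp: r_coset_def)
  have "emeasure \<nu> (E #> y) \<le> emeasure \<nu> (K #> y)"
    using assms by (intro emeasure_mono) (auto simp: r_coset_def compactin_borel r_coset_borel[unfolded r_coset_def])
  also have "\<dots> < \<infinity>" using assms by (intro compact_finite compactin_r_coset)
  finally show "emeasure \<nu> (E #> y) \<noteq> \<infinity>" by simp
qed

lemma pos_finite:
  assumes "openin T E" "E \<noteq> {}" "compactin T K" "E \<subseteq> K"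
  shows "emeasure \<nu> E \<noteq> 0" "emeasure \<nu> E \<noteq> \<infinity>"
proof -
  have "E #> \<one> = E" using openin_subset[OF assms(1)] by (auto simp: r_coset_eq)
  then show "emeasure \<nu> E \<noteq> 0" "emeasure \<nu> E \<noteq> \<infinity>"
    using r_coset_pos_finite[OF assms one_closed] by auto
qed

text \<open>The map \<open>(x, y) \<mapsto> (y \<otimes> x, inv x)\<close> preserves \<open>\<mu> \<times> \<nu>\<close>; the identity is obtained by integrating
  the function \<open>1\<^sub>E(x) h(inv y) / \<nu>(E y)\<close> along it.\<close>

lemma nn_integral_haar_eq:
  assumes \<mu>: "left_haar G T \<mu>"
    and E: "openin T E" "E \<noteq> {}" "compactin T K" "E \<subseteq> K"
    and h [measurable]: "h \<in> borel_measurable B"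
  shows "(\<integral>\<^sup>+ x. h x \<partial>\<mu>) = emeasure \<mu> E * (\<integral>\<^sup>+ y. h (inv y) / emeasure \<nu> (E #> y) \<partial>\<nu>)"
proof -
  interpret \<mu>: left_haar G T \<mu> by fact
  interpret P: pair_sigma_finite \<mu> \<nu>
    using sigma_finite \<mu>.sigma_finite by (simp add: pair_sigma_finite_def)
  have EB [measurable]: "E \<in> sets B" using E(1) by (rule openin_imp_borel_on)
  \<comment> \<open>This is \<open>emeasure \<nu> (E #> y)\<close>, written as a parameter integral
    so that measurability in \<open>y\<close> is automatic.\<close>
  define d where "d y = (\<integral>\<^sup>+ x. indicator E (x \<otimes> inv y) \<partial>\<nu>)" for y
  have d_meas [measurable]: "d \<in> borel_measurable B"
    unfolding d_def by measurable
  have d: "d y = emeasure \<nu> (E #> y)" if "y \<in> carrier G" for y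
  proof -
    have "d y = (\<integral>\<^sup>+ x. indicator (E #> y) x \<partial>\<nu>)"
      unfolding d_def using that openin_subset[OF E(1)]
      by (intro nn_integral_cong) (auto simp: r_coset_eq indicator_def)
    then show ?thesis using that by (simp add: r_coset_borel)
  qed
  define w where "w y = h (inv y) / d y" for y
  have w [measurable]: "w \<in> borel_measurable B" unfolding w_def by measurable
  have "emeasure \<mu> E * (\<integral>\<^sup>+ y. h (inv y) / emeasure \<nu> (E #> y) \<partial>\<nu>) = emeasure \<mu> E * (\<integral>\<^sup>+ y. w y \<partial>\<nu>)"
    by (intro arg_cong[of _ _ "\<lambda>t. emeasure \<mu> E * t"] nn_integral_cong) (simp add: w_def d)
  also have "\<dots> = (\<integral>\<^sup>+ x. indicator E x * (\<integral>\<^sup>+ y. w y \<partial>\<nu>) \<partial>\<mu>)"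
    by (simp add: nn_integral_multc)
  \<comment> \<open>Left invariance of \<open>\<nu>\<close> for fixed \<open>x\<close>; after
    exchanging the integrals, left invariance of \<open>\<mu>\<close> for fixed \<open>y\<close>
    replaces \<open>x\<close> by \<open>y \<otimes> x\<close>.\<close>
  also have "\<dots> = (\<integral>\<^sup>+ x. (\<integral>\<^sup>+ y. indicator E x * w (inv x \<otimes> y) \<partial>\<nu>) \<partial>\<mu>)"
  proof (intro nn_integral_cong)
    fix x assume "x \<in> space \<mu>"
    then have x: "inv x \<in> carrier G" by simp
    show "indicator E x * (\<integral>\<^sup>+ y. w y \<partial>\<nu>) = (\<integral>\<^sup>+ y. indicator E x * w (inv x \<otimes> y) \<partial>\<nu>)"
      using nn_integral_left[OF x w] x by (subst nn_integral_cmult) auto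
  qed
  also have "\<dots> = (\<integral>\<^sup>+ y. (\<integral>\<^sup>+ x. indicator E x * w (inv x \<otimes> y) \<partial>\<mu>) \<partial>\<nu>)"
    by (subst P.Fubini'[symmetric]) auto
  also have "\<dots> = (\<integral>\<^sup>+ y. (\<integral>\<^sup>+ x. indicator E (y \<otimes> x) * w (inv x) \<partial>\<mu>) \<partial>\<nu>)"
  proof (rule nn_integral_cong)
    fix y assume "y \<in> space \<nu>"
    then have y: "y \<in> carrier G" by simp
    have [measurable]: "(\<lambda>x. indicator E x * w (inv x \<otimes> y)) \<in> borel_measurable B"
      using y by measurable
    have "(\<integral>\<^sup>+ x. indicator E x * w (inv x \<otimes> y) \<partial>\<mu>)
        = (\<integral>\<^sup>+ x. indicator E (y \<otimes> x) * w (inv (y \<otimes> x) \<otimes> y) \<partial>\<mu>)"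
      by (subst \<mu>.nn_integral_left[OF y]) auto
    also have "\<dots> = (\<integral>\<^sup>+ x. indicator E (y \<otimes> x) * w (inv x) \<partial>\<mu>)"
      using y by (intro nn_integral_cong) (auto simp: inv_mult_group m_assoc)
    finally show "(\<integral>\<^sup>+ x. indicator E x * w (inv x \<otimes> y) \<partial>\<mu>)
        = (\<integral>\<^sup>+ x. indicator E (y \<otimes> x) * w (inv x) \<partial>\<mu>)" .
  qed
  also have "\<dots> = (\<integral>\<^sup>+ x. (\<integral>\<^sup>+ y. indicator E (y \<otimes> x) * w (inv x) \<partial>\<nu>) \<partial>\<mu>)"
    by (rule P.Fubini') auto
  also have "\<dots> = (\<integral>\<^sup>+ x. h x \<partial>\<mu>)"
  proof (intro nn_integral_cong)
    fix x assume "x \<in> space \<mu>"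
    then have x: "x \<in> carrier G" by simp
    have "(\<integral>\<^sup>+ y. indicator E (y \<otimes> x) * w (inv x) \<partial>\<nu>) = d (inv x) * w (inv x)"
      using x unfolding d_def by (subst nn_integral_multc) auto
    \<comment> \<open>The denominator of \<open>w (inv x)\<close> is \<open>d (inv x)\<close>, which
      is positive and finite and therefore cancels.\<close>
    also have "\<dots> = h x"
      using x r_coset_pos_finite[OF E, of "inv x"]
      by (simp add: w_def d ennreal_times_divide mult.commute[of _ "h x"] mult_divide_eq_ennreal)
    finally show "(\<integral>\<^sup>+ y. indicator E (y \<otimes> x) * w (inv x) \<partial>\<nu>) = h x" .
  qed
  finally show ?thesis by simp
qed

text \<open>The integral in \<open>nn_integral_haar_eq\<close> involves \<open>\<nu>\<close> alone.
  Applying the formula to \<open>\<mu>\<close> and to \<open>\<nu>\<close> itself gives the same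
  factor \<open>C\<close>. The cross-multiplied form also covers sets \<open>A\<close> of infinite
  measure.\<close>

lemma haar_unique:
  assumes \<mu>: "left_haar G T \<mu>"
    and E: "openin T E" "E \<noteq> {}" "compactin T K" "E \<subseteq> K"
    and A: "A \<in> sets B"
  shows "emeasure \<mu> A * emeasure \<nu> E = emeasure \<nu> A * emeasure \<mu> E"
proof -
  interpret \<mu>: left_haar G T \<mu> by fact
  have \<nu>: "left_haar G T \<nu>" by unfold_locales
  define C where "C = (\<integral>\<^sup>+ y. indicator A (inv y) / emeasure \<nu> (E #> y) \<partial>\<nu>)"
  have "emeasure \<mu> A = emeasure \<mu> E * C" "emeasure \<nu> A = emeasure \<nu> E * C"
    using nn_integral_haar_eq[OF \<mu> E, of "indicator A"] nn_integral_haar_eq[OF \<nu> E, of "indicator A"] A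
    by (simp_all add: C_def)
  then show ?thesis by (simp add: mult_ac)
qed

end

section \<open>The modular function and its kernel\<close>

context lcsc_topological_group
begin

text \<open>Provides a reference set whose measure is positive and finite for every left Haar
  measure.\<close>

lemma compact_neighbourhood:
  obtains E K where "openin T E" "E \<noteq> {}" "compactin T K" "E \<subseteq> K"
  using locally_compact one_closed unfolding locally_compact_space_def topspace_eq by (metis empty_iff)

text \<open>Shows that the witness chosen in \<open>haar_probability\<close> does not affect the
  measure class.\<close>

lemma null_sets_haar_unique:
  assumes "left_haar G T \<mu>" "left_haar G T \<nu>"
  shows "null_sets \<mu> = null_sets \<nu>"
proof -
  interpret \<mu>: left_haar G T \<mu> by fact
  interpret \<nu>: left_haar G T \<nu> by fact
  obtain E K where E: "openin T E" "E \<noteq> {}" "compactin T K" "E \<subseteq> K"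
    by (rule compact_neighbourhood)
  have "emeasure \<mu> A = 0 \<longleftrightarrow> emeasure \<nu> A = 0" if "A \<in> sets B" for A
    using \<nu>.haar_unique[OF assms(1) E that] \<mu>.pos_finite[OF E] \<nu>.pos_finite[OF E]
    by (metis mult_eq_0_iff)
  then show ?thesis by (auto simp: null_sets_def)
qed

text \<open>\<open>modular_function\<close> is a definite description over all left Haar measures,
  so it means something only once existence and uniqueness of the factor are known. Both come from
  \<open>haar_unique\<close>, applied to right translates. The last claim allows the factor to be
  identified from a single Haar measure.\<close>

lemma modular_function_eq:
  assumes \<nu>: "left_haar G T \<nu>" and g: "g \<in> carrier G"
  shows "0 < modular_function G T g"
    and "A \<in> sets B \<Longrightarrow> emeasure \<nu> (A #> g) = ennreal (modular_function G T g) * emeasure \<nu> A"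
    and "\<lbrakk>0 < c; \<And>A. A \<in> sets B \<Longrightarrow> emeasure \<nu> (A #> g) = ennreal c * emeasure \<nu> A\<rbrakk>
      \<Longrightarrow> modular_function G T g = c"
proof -
  interpret \<nu>: left_haar G T \<nu> by fact
  obtain E K where E: "openin T E" "E \<noteq> {}" "compactin T K" "E \<subseteq> K"
    by (rule compact_neighbourhood)
  have EB: "E \<in> sets B" using E(1) by (rule openin_imp_borel_on)
  \<comment> \<open>The only possible factor, read off at the reference set; the quotient is
    positive and finite, so \<open>enn2real\<close> loses nothing.\<close>
  define c where "c = enn2real (emeasure \<nu> (E #> g) / emeasure \<nu> E)"
  note E\<nu> = \<nu>.pos_finite[OF E] \<nu>.r_coset_pos_finite[OF E g]
  have fin: "emeasure \<nu> (E #> g) / emeasure \<nu> E < \<infinity>" "emeasure \<nu> (E #> g) / emeasure \<nu> E \<noteq> 0"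
    using E\<nu> by (auto simp: ennreal_divide_eq_top_iff less_top[symmetric] ennreal_divide_eq_0_iff)
  then have c: "ennreal c = emeasure \<nu> (E #> g) / emeasure \<nu> E" "0 < c"
    by (auto simp: c_def enn2real_positive_iff zero_less_iff_neq_zero)
  have mult: "emeasure \<mu> (A #> g) = ennreal c * emeasure \<mu> A"
    if \<mu>: "left_haar_measure G T \<mu>" and A: "A \<in> sets B" for \<mu> A
  proof -
    interpret \<mu>: left_haar G T \<mu> using \<mu> by unfold_locales
    interpret \<mu>': left_haar G T "distr \<mu> B (\<lambda>x. x \<otimes> inv g)"
      using \<mu>.right_translate_haar[OF g] by unfold_locales
    have "emeasure \<mu> (A #> g) * emeasure \<nu> E = emeasure \<nu> A * emeasure \<mu> (E #> g)"
      using \<nu>.haar_unique[OF \<mu>'.left_haar_axioms E A] A EB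
      by (simp add: \<mu>.right_translate_haar[OF g])
    moreover have "emeasure \<mu> (E #> g) * emeasure \<nu> E = emeasure \<nu> (E #> g) * emeasure \<mu> E"
      using \<nu>.haar_unique[OF \<mu>.left_haar_axioms E r_coset_borel[OF EB g]] .
    moreover have "emeasure \<mu> A * emeasure \<nu> E = emeasure \<nu> A * emeasure \<mu> E"
      using \<nu>.haar_unique[OF \<mu>.left_haar_axioms E A] .
    \<comment> \<open>The extra factor \<open>emeasure \<nu> E\<close> lets the other two identities
      be substituted into the first; being positive and finite, it can then be cancelled.\<close>
    ultimately have "emeasure \<mu> (A #> g) * emeasure \<nu> E * emeasure \<nu> E
        = emeasure \<nu> (E #> g) * emeasure \<mu> A * emeasure \<nu> E"
      by (metis mult.assoc mult.commute)
    then have "emeasure \<mu> (A #> g) * emeasure \<nu> E = emeasure \<nu> (E #> g) * emeasure \<mu> A"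
      using E\<nu> by (simp add: ennreal_mult_cancel_left mult.commute[of _ "emeasure \<nu> E"])
    then have "emeasure \<mu> (A #> g) * emeasure \<nu> E / emeasure \<nu> E
        = emeasure \<nu> (E #> g) * emeasure \<mu> A / emeasure \<nu> E" by simp
    then show ?thesis
      using E\<nu> mult_divide_eq_ennreal[of "emeasure \<nu> E" "emeasure \<mu> (A #> g)"]
      by (simp add: c ennreal_times_divide mult.commute)
  qed
  have uniq: "a = c" if "0 < a" "\<And>A. A \<in> sets B \<Longrightarrow> emeasure \<nu> (A #> g) = ennreal a * emeasure \<nu> A" for a
  proof -
    have "ennreal a * emeasure \<nu> E = ennreal c * emeasure \<nu> E"
      using that(2)[OF EB] mult[OF \<nu>.haar EB] by simp
    then have "ennreal a = ennreal c" using E\<nu> by (simp add: ennreal_mult_cancel_left mult.commute[of _ "emeasure \<nu> E"])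
    then show ?thesis using that(1) c(2) by simp
  qed
  have mf: "modular_function G T g = c"
    unfolding modular_function_def
  proof (rule the_equality)
    show "0 < c \<and> (\<forall>\<nu>. left_haar_measure G T \<nu> \<longrightarrow>
        (\<forall>A\<in>sets \<nu>. emeasure \<nu> (A #> g) = ennreal c * emeasure \<nu> A))"
      using c mult by (auto simp: left_haar_measure_def)
    fix a assume "0 < a \<and> (\<forall>\<nu>. left_haar_measure G T \<nu> \<longrightarrow>
        (\<forall>A\<in>sets \<nu>. emeasure \<nu> (A #> g) = ennreal a * emeasure \<nu> A))"
    then show "a = c" using uniq[of a] \<nu>.haar \<nu>.sets_eq by metis
  qed
  show "0 < modular_function G T g" using mf c by simp
  show "emeasure \<nu> (A #> g) = ennreal (modular_function G T g) * emeasure \<nu> A" if "A \<in> sets B"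
    using mf mult[OF \<nu>.haar that] by simp
  show "modular_function G T g = c'"
    if "0 < c'" "\<And>A. A \<in> sets B \<Longrightarrow> emeasure \<nu> (A #> g) = ennreal c' * emeasure \<nu> A" for c'
    using mf uniq[OF that] by simp
qed

text \<open>Trades the definite description for right invariance of one Haar measure, from which
  closure under products and inverses is immediate.\<close>

lemma mem_modular_kernel_iff:
  assumes "left_haar G T \<nu>"
  shows "g \<in> modular_kernel G T \<longleftrightarrow>
    g \<in> carrier G \<and> (\<forall>A\<in>sets B. emeasure \<nu> (A #> g) = emeasure \<nu> A)"
proof
  assume "g \<in> modular_kernel G T"
  then show "g \<in> carrier G \<and> (\<forall>A\<in>sets B. emeasure \<nu> (A #> g) = emeasure \<nu> A)"
    using modular_function_eq(2)[OF assms, of g] by (simp add: modular_kernel_def)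
next
  assume "g \<in> carrier G \<and> (\<forall>A\<in>sets B. emeasure \<nu> (A #> g) = emeasure \<nu> A)"
  then show "g \<in> modular_kernel G T"
    using modular_function_eq(3)[OF assms, of g 1] by (simp add: modular_kernel_def)
qed

lemma subgroup_modular_kernel:
  assumes \<nu>: "left_haar G T \<nu>"
  shows "subgroup (modular_kernel G T) G"
proof (rule subgroupI)
  note iff = mem_modular_kernel_iff[OF \<nu>]
  show "modular_kernel G T \<subseteq> carrier G" by (auto simp: modular_kernel_def)
  have "\<one> \<in> modular_kernel G T"
    using borel_subset by (auto simp: iff coset_mult_one)
  then show "modular_kernel G T \<noteq> {}" by blast
  fix g assume g: "g \<in> modular_kernel G T"
  then have gc: "g \<in> carrier G" by (simp add: iff)
  have "emeasure \<nu> (A #> inv g) = emeasure \<nu> A" if A: "A \<in> sets B" for A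
  proof -
    have "emeasure \<nu> ((A #> inv g) #> g) = emeasure \<nu> (A #> inv g)"
      using g A gc by (simp add: iff r_coset_borel)
    then show ?thesis
      using A gc borel_subset[OF A] by (simp add: coset_mult_assoc coset_mult_one)
  qed
  then show "inv g \<in> modular_kernel G T" using gc by (simp add: iff)
  fix h assume h: "h \<in> modular_kernel G T"
  show "g \<otimes> h \<in> modular_kernel G T"
    using g h by (auto simp: iff r_coset_borel coset_mult_assoc[symmetric] borel_subset)
qed

end

section \<open>Almost invariant sequences of left translations\<close>

text \<open>The product is unchanged when a set is replaced by its complement. Triviality thus
  becomes convergence to 0 after suitable complements, a form that passes between equivalent
  measures.\<close>

lemma trivial_sequence_iff:
  fixes A :: "nat \<Rightarrow> 'a set"
  assumes "prob_space M" and A: "\<And>n. A n \<in> sets M"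
  shows "trivial_sequence M A \<longleftrightarrow>
    (\<exists>S. (\<lambda>n. measure M (if n \<in> S then space M - A n else A n)) \<longlonglongrightarrow> 0)"
proof -
  interpret prob_space M by fact
  let ?f = "\<lambda>S n. measure M (if n \<in> S then space M - A n else A n)"
  have eq: "measure M (A n) * (1 - measure M (A n)) = ?f S n * (1 - ?f S n)" for S n
    using prob_compl[OF A[of n]] by simp
  show ?thesis
  proof
    assume "trivial_sequence M A"
    then have lim: "(\<lambda>n. measure M (A n) * (1 - measure M (A n))) \<longlonglongrightarrow> 0"
      by (simp add: trivial_sequence_def)
    \<comment> \<open>Complementing exactly these sets leaves measures p with p \<le> 1/2, hence p
      \<le> 2p(1 - p).\<close>
    define S where "S = {n. measure M (A n) > 1/2}"
    have "?f S n \<le> 2 * (measure M (A n) * (1 - measure M (A n)))" for n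
    proof -
      have "?f S n \<le> 1/2" using prob_compl[OF A[of n]] by (simp add: S_def)
      then have "?f S n * (2 * ?f S n) \<le> ?f S n * 1" by (intro mult_left_mono) auto
      then show ?thesis by (simp only: eq[of n S]) (simp only: algebra_simps)
    qed
    moreover have "(\<lambda>n. 2 * (measure M (A n) * (1 - measure M (A n)))) \<longlonglongrightarrow> 0"
      using tendsto_mult_left[OF lim, of 2] by simp
    ultimately have "?f S \<longlonglongrightarrow> 0"
      by (intro Lim_null_comparison[where f = "?f S"] always_eventually)
        (simp_all only: real_norm_def abs_of_nonneg measure_nonneg simp_thms)
    then show "\<exists>S. ?f S \<longlonglongrightarrow> 0" by blast
  next
    assume "\<exists>S. ?f S \<longlonglongrightarrow> 0"
    then obtain S where "?f S \<longlonglongrightarrow> 0" by blast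
    then have "(\<lambda>n. ?f S n * (1 - ?f S n)) \<longlonglongrightarrow> 0 * (1 - 0)"
      by (intro tendsto_intros)
    then show "trivial_sequence M A"
      unfolding trivial_sequence_def eq[of _ S] by simp
  qed
qed

lemma (in group) inv_mult_cancel:
  assumes "x \<in> carrier G" "y \<in> carrier G"
  shows "inv x \<otimes> (x \<otimes> y) = y" "x \<otimes> (inv x \<otimes> y) = y"
  using assms by (simp_all add: m_assoc[symmetric])

section \<open>Probability measures in the Haar class and their full groups\<close>

locale haar_prob = lcsc_topological_group G T for G :: "('a, 'b) monoid_scheme" (structure) and T +
  fixes \<mu> :: "'a measure"
  assumes haar_probability: "haar_probability G T \<mu>"
begin

sublocale prob_space \<mu>
  using haar_probability by (simp add: haar_probability_def)

lemma sets_eq [measurable_cong, simp]: "sets \<mu> = sets B"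
  using haar_probability by (simp add: haar_probability_def)

lemma space_eq [simp]: "space \<mu> = carrier G"
  using sets_eq_imp_space_eq[OF sets_eq] by simp

lemma haar_measure:
  obtains \<nu> where "left_haar G T \<nu>" "null_sets \<mu> = null_sets \<nu>"
  using haar_probability lcsc_topological_group_axioms unfolding haar_probability_def
  by (auto simp: left_haar_def left_haar_axioms_def)

lemma l_coset_null_iff:
  assumes "g \<in> carrier G" "A \<in> sets B"
  shows "emeasure \<mu> (g <# A) = 0 \<longleftrightarrow> emeasure \<mu> A = 0"
proof -
  obtain \<nu> where \<nu>: "left_haar G T \<nu>" "null_sets \<mu> = null_sets \<nu>" by (rule haar_measure)
  interpret \<nu>: left_haar G T \<nu> by fact
  have "emeasure \<mu> A = 0 \<longleftrightarrow> emeasure \<nu> A = 0" if "A \<in> sets B" for A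
    using that \<nu>(2) by (auto simp: null_sets_def set_eq_iff)
  with \<nu>.left_invariant[OF assms] assms l_coset_borel[OF assms(2,1)] show ?thesis by simp
qed

text \<open>Only the null sets of \<open>\<mu>\<close> are translation invariant; absolute
  continuity of the translated measure turns this into preservation of limits 0.\<close>

lemma tendsto_l_coset:
  assumes g: "g \<in> carrier G" and A: "\<And>n. A n \<in> sets B"
    and lim: "(\<lambda>n. measure \<mu> (A n)) \<longlonglongrightarrow> 0"
  shows "(\<lambda>n. measure \<mu> (g <# A n)) \<longlonglongrightarrow> 0"
proof -
  let ?N = "distr \<mu> B (\<lambda>x. inv g \<otimes> x)"
  have N: "emeasure ?N C = emeasure \<mu> (g <# C)" if "C \<in> sets B" for C
    using g that by (subst emeasure_distr)
      (auto simp: l_coset_eq borel_subset intro!: arg_cong[of _ _ "emeasure \<mu>"])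
  have "(\<lambda>n. measure ?N (A n)) \<longlonglongrightarrow> 0"
  proof (rule tendsto_measure_absolutely_continuous[OF _ _ _ _ _ lim])
    show "null_sets \<mu> \<subseteq> null_sets ?N"
      using N l_coset_null_iff[OF g] by (auto simp: null_sets_def)
    show "finite_measure ?N"
      using g by (intro finite_measure_distr) auto
  qed (use A in \<open>auto intro: finite_measure_axioms\<close>)
  then show ?thesis using N[OF A] by (simp add: measure_def)
qed

lemma tendsto_subset:
  assumes "\<And>n. C n \<in> sets B" "\<And>n. A n \<subseteq> C n" "(\<lambda>n. measure \<mu> (C n)) \<longlonglongrightarrow> 0"
  shows "(\<lambda>n. measure \<mu> (A n)) \<longlonglongrightarrow> 0"
  by (rule tendsto_sandwich[OF _ _ tendsto_const assms(3)])
    (use assms in \<open>auto intro!: always_eventually finite_measure_mono\<close>)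

lemma left_translation_in_full_group:
  assumes \<Gamma>: "subgroup \<Gamma> G" and g: "g \<in> \<Gamma>"
  shows "left_translation G g \<in> full_group \<mu> (orbit_relation (G\<lparr>carrier := \<Gamma>\<rparr>) (left_translation G) (space \<mu>))"
proof -
  have gc: "g \<in> carrier G" using \<Gamma> g by (rule subgroup.mem_carrier)
  let ?f = "left_translation G g"
  have f: "?f x = g \<otimes> x" if "x \<in> carrier G" for x using that by (simp add: left_translation_def)
  have inj: "inj_on ?f (carrier G)"
    using gc by (auto simp: inj_on_def f)
  have img: "?f ` A = g <# A" if "A \<subseteq> carrier G" for A
    using that f unfolding l_coset_def UNION_singleton_eq_range by (intro image_cong) auto
  have bij: "bij_betw ?f (carrier G) (carrier G)"
    using inj gc by (auto simp: bij_betw_def img l_coset_eq)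
  have inv: "inv_into (carrier G) ?f x = inv g \<otimes> x" if "x \<in> carrier G" for x
    by (rule inv_into_f_eq[OF inj]) (use gc that in \<open>auto simp: f inv_mult_cancel\<close>)
  have "nonsingular_automorphism \<mu> ?f"
    unfolding nonsingular_automorphism_def
  proof (intro conjI ballI)
    show "bij_betw ?f (space \<mu>) (space \<mu>)" using bij by simp
    show "?f \<in> measurable \<mu> \<mu>"
      by (subst measurable_cong[of _ _ "\<lambda>x. g \<otimes> x"]) (use gc f in \<open>auto cong: measurable_cong_sets\<close>)
    show "inv_into (space \<mu>) ?f \<in> measurable \<mu> \<mu>"
      by (subst measurable_cong[of _ _ "\<lambda>x. inv g \<otimes> x"]) (use gc inv in \<open>auto cong: measurable_cong_sets\<close>)
    fix A assume "A \<in> sets \<mu>"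
    then show "emeasure \<mu> (?f ` A) = 0 \<longleftrightarrow> emeasure \<mu> A = 0"
      using gc by (simp add: img borel_subset l_coset_null_iff)
  qed
  moreover have "(?f x, x) \<in> orbit_relation (G\<lparr>carrier := \<Gamma>\<rparr>) (left_translation G) (space \<mu>)"
    if "x \<in> carrier G" for x
    using that gc f subgroup.m_inv_closed[OF \<Gamma> g]
    \<comment> \<open>The relation asks for \<open>x\<close> in the orbit of its image, so the
      witness is the inverse of \<open>g\<close>.\<close>
    by (auto simp: orbit_relation_def orbit_def left_translation_def inv_mult_cancel intro!: exI[of _ "inv g"])
  ultimately show ?thesis by (auto simp: full_group_def)
qed

lemma almost_invariant_sequence_iff:
  assumes \<Gamma>: "subgroup \<Gamma> G" and cnt: "countable \<Gamma>"
  shows "almost_invariant_sequence \<mu> (orbit_relation (G\<lparr>carrier := \<Gamma>\<rparr>) (left_translation G) (space \<mu>)) A \<longleftrightarrow>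
    (\<forall>n. A n \<in> sets B) \<and> (\<forall>g\<in>\<Gamma>. (\<lambda>n. measure \<mu> (sym_diff (A n) (g <# A n))) \<longlonglongrightarrow> 0)"
    (is "almost_invariant_sequence \<mu> ?R A \<longleftrightarrow> ?rhs")
proof
  assume *: "almost_invariant_sequence \<mu> ?R A"
  then have A: "A n \<in> sets B" for n by (simp add: almost_invariant_sequence_def)
  have "left_translation G g ` A n = g <# A n" for g n
    using borel_subset[OF A, of n] unfolding left_translation_def l_coset_def UNION_singleton_eq_range
    by (intro image_cong) auto
  with * left_translation_in_full_group[OF \<Gamma>] A show ?rhs
    unfolding almost_invariant_sequence_def by fastforce
next
  assume ?rhs
  then have A: "\<And>n. A n \<in> sets B"
    and lim: "\<And>g. g \<in> \<Gamma> \<Longrightarrow> (\<lambda>n. measure \<mu> (sym_diff (A n) (g <# A n))) \<longlonglongrightarrow> 0" by auto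
  have "(\<lambda>n. measure \<mu> (sym_diff (A n) (f ` A n))) \<longlonglongrightarrow> 0" if f: "f \<in> full_group \<mu> ?R" for f
  proof -
    define f' where "f' = inv_into (carrier G) f"
    have bij: "bij_betw f (carrier G) (carrier G)" and f'_meas: "f' \<in> measurable B B"
      and null: "\<And>C. C \<in> sets B \<Longrightarrow> emeasure \<mu> (f ` C) = 0 \<longleftrightarrow> emeasure \<mu> C = 0"
      using f by (auto simp: full_group_def nonsingular_automorphism_def f'_def cong: measurable_cong_sets)
    have f': "f' x \<in> carrier G" "f (f' x) = x" if "x \<in> carrier G" for x
      using bij that unfolding f'_def bij_betw_def by (auto intro: inv_into_into f_inv_into_f)
    have f'_f: "f' (f x) = x" "f x \<in> carrier G" if "x \<in> carrier G" for x
      using bij that unfolding f'_def bij_betw_def by auto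
    have img: "f ` C = {x \<in> carrier G. f' x \<in> C}" if "C \<subseteq> carrier G" for C
    proof (intro equalityI subsetI)
      fix x assume x: "x \<in> {x \<in> carrier G. f' x \<in> C}"
      then have "x = f (f' x)" using f' by simp
      then show "x \<in> f ` C" using x by blast
    qed (use that f'_f in auto)
    have img_borel: "f ` C \<in> sets B" if "C \<in> sets B" for C
      using measurable_sets[OF f'_meas that] that
      by (simp add: img borel_subset vimage_def Int_def conj_commute)
    define e where "e = from_nat_into \<Gamma>"
    have ne: "\<Gamma> \<noteq> {}" using subgroup.one_closed[OF \<Gamma>] by blast
    have e: "e k \<in> \<Gamma>" "e k \<in> carrier G" for k
      using from_nat_into[OF ne] subgroup.mem_carrier[OF \<Gamma>] by (auto simp: e_def)
    have e_surj: "\<exists>k. g = e k" if "g \<in> \<Gamma>" for g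
      unfolding e_def using from_nat_into_surj[OF cnt that] by metis
    define P where "P k = {x \<in> carrier G. e k \<otimes> f' x = x}" for k
    have P: "P k \<in> sets B" for k
    proof -
      have "closedin T {\<one>}"
        using Hausdorff by (simp add: closedin_Hausdorff_singleton)
      then have [measurable]: "{\<one>} \<in> sets B" by (rule closedin_imp_borel_on)
      have "P k = {x \<in> space B. inv x \<otimes> (e k \<otimes> f' x) \<in> {\<one>}}"
      proof -
        have "inv x \<otimes> y = \<one> \<longleftrightarrow> y = x" if "x \<in> carrier G" "y \<in> carrier G" for x y
          using that by (metis inv_mult_cancel(2) l_inv r_one)
        then show ?thesis using e f' by (auto simp: P_def)
      qed
      also have "\<dots> \<in> sets B"
        using e f'_meas by measurable
      finally show ?thesis .
    qed
    have cover: "AE x in \<mu>. \<exists>k. x \<in> P k"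
    proof -
      have "AE x in \<mu>. (f x, x) \<in> ?R" using f by (simp add: full_group_def)
      then obtain N where N: "N \<in> null_sets \<mu>" "{x \<in> space \<mu>. (f x, x) \<notin> ?R} \<subseteq> N"
        by (auto simp: eventually_ae_filter)
      have NB: "N \<in> sets B" using N by auto
      have "f ` N \<in> null_sets \<mu>"
        using N NB null[OF NB] img_borel[OF NB] by auto
      moreover have "{x \<in> space \<mu>. \<not> (\<exists>k. x \<in> P k)} \<subseteq> f ` N"
      proof safe
        fix x assume x: "x \<in> space \<mu>" "\<nexists>k. x \<in> P k"
        have "f' x \<in> N"
        proof (rule ccontr)
          assume "f' x \<notin> N"
          then have "(x, f' x) \<in> ?R" using N(2) x f'[of x] by auto
          then obtain g where g: "g \<in> \<Gamma>" "f' x = g \<otimes> x"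
            using x(1) by (auto simp: orbit_relation_def orbit_def left_translation_def)
          then have "inv g \<otimes> f' x = x"
            using x subgroup.mem_carrier[OF \<Gamma>] by (simp add: inv_mult_cancel)
          moreover obtain k where "inv g = e k" using e_surj subgroup.m_inv_closed[OF \<Gamma> g(1)] by blast
          ultimately show False using x by (auto simp: P_def)
        qed
        then show "x \<in> f ` N" using x f'[of x] by (metis imageI space_eq)
      qed
      ultimately show ?thesis by (rule AE_I')
    qed
    have small: "(\<lambda>n. measure \<mu> (sym_diff (A n) (f ` A n) \<inter> P k)) \<longlonglongrightarrow> 0" for k
    proof (rule tendsto_subset[OF _ _ lim[OF e(1)[of k]]])
      fix n
      show "sym_diff (A n) (e k <# A n) \<in> sets B"
        using A[of n] e(2) l_coset_borel by auto
      have "x \<in> f ` A n \<longleftrightarrow> x \<in> e k <# A n" if x: "x \<in> P k" for x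
      proof -
        have "x \<in> carrier G" "e k \<otimes> f' x = x" using x by (auto simp: P_def)
        then have "inv (e k) \<otimes> x = f' x"
          using e(2) f' by (metis inv_mult_cancel(1))
        then show ?thesis
          using \<open>x \<in> carrier G\<close> e(2) borel_subset[OF A] by (simp add: img l_coset_eq)
      qed
      then show "sym_diff (A n) (f ` A n) \<inter> P k \<subseteq> sym_diff (A n) (e k <# A n)" by blast
    qed
    have "sym_diff (A n) (f ` A n) \<in> sets \<mu>" for n
      using A[of n] img_borel[OF A[of n]] by auto
    moreover have "P k \<in> sets \<mu>" for k using P by simp
    ultimately show ?thesis
      by (rule tendsto_measure_cover[OF finite_measure_axioms _ _ cover small])
  qed
  with A show "almost_invariant_sequence \<mu> ?R A"
    by (simp add: almost_invariant_sequence_def)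
qed

end

section \<open>Open subgroups\<close>

text \<open>Openness of \<open>H\<close> enters through local compactness; the other topological
  properties pass to any subspace.\<close>

lemma (in lcsc_topological_group) lcsc_open_subgroup:
  assumes H: "subgroup H G" "openin T H"
  shows "lcsc_topological_group (G\<lparr>carrier := H\<rparr>) (subtopology T H)"
proof -
  have HG: "H \<subseteq> carrier G" using H(1) by (rule subgroup.subset)
  have grp: "group (G\<lparr>carrier := H\<rparr>)" using H(1) by (rule subgroup_imp_group)
  have "continuous_map (subtopology (prod_topology T T) (H \<times> H)) (subtopology T H) (\<lambda>(x, y). x \<otimes> y)"
    using continuous_map_from_subtopology[OF continuous_mult] subgroup.m_closed[OF H(1)]
    by (auto simp: continuous_map_in_subtopology)
  moreover have "continuous_map (subtopology T H) (subtopology T H) (\<lambda>x. inv\<^bsub>G\<lparr>carrier := H\<rparr>\<^esub> x)"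
  proof (rule continuous_map_eq)
    show "continuous_map (subtopology T H) (subtopology T H) (\<lambda>x. inv x)"
      using continuous_map_from_subtopology[OF continuous_inv] subgroup.m_inv_closed[OF H(1)]
      by (auto simp: continuous_map_in_subtopology)
  qed (use H in auto)
  ultimately have "topological_group (G\<lparr>carrier := H\<rparr>) (subtopology T H)"
    using grp HG by (simp add: topological_group_def subtopology_Times Int_absorb1)
  then have "lcsc_group (G\<lparr>carrier := H\<rparr>) (subtopology T H)"
    using H(2) Hausdorff locally_compact second_countable
    by (simp add: lcsc_group_def Hausdorff_space_subtopology locally_compact_space_open_subset
        second_countable_subtopology)
  with grp show ?thesis
    by (simp add: lcsc_topological_group_def lcsc_topological_group_axioms_def)
qed

lemma sets_borel_on_open_subtopology:
  assumes "openin T H"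
  shows "sets (borel_on (subtopology T H)) = {A \<in> sets (borel_on T). A \<subseteq> H}"
proof -
  have HT: "H \<subseteq> topspace T" using assms by (rule openin_subset)
  have "sets (borel_on (subtopology T H)) = sigma_sets H {U \<inter> H |U. openin T U}"
    using HT by (simp add: sets_borel_on openin_subtopology Int_absorb1 conj_commute)
  also have "{U \<inter> H |U. openin T U} = (\<inter>) H ` {U. openin T U}"
    by auto
  also have "sigma_sets H \<dots> = (\<inter>) H ` sigma_sets (topspace T) {U. openin T U}"
    using HT assms by (subst sigma_sets_Int) auto
  also have "\<dots> = {A \<in> sets (borel_on T). A \<subseteq> H}"
    using openin_imp_borel_on[OF assms] unfolding sets_borel_on[symmetric] by (auto simp: Int_absorb1 image_iff)
  finally show ?thesis .
qed

text \<open>Openness ensures that the restriction is nonzero, by \<open>open_pos\<close>; invariance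
  and finiteness on compact sets are inherited.\<close>

lemma (in left_haar) left_haar_open_subgroup:
  assumes H: "subgroup H G" "openin T H"
  shows "left_haar (G\<lparr>carrier := H\<rparr>) (subtopology T H) (restrict_space \<nu> H)"
proof -
  interpret H: lcsc_topological_group "G\<lparr>carrier := H\<rparr>" "subtopology T H"
    using H by (rule lcsc_open_subgroup)
  have HB: "H \<in> sets B" using H(2) by (rule openin_imp_borel_on)
  have HG: "H \<subseteq> carrier G" using H(1) by (rule subgroup.subset)
  have sets: "sets (restrict_space \<nu> H) = {A \<in> sets B. A \<subseteq> H}"
    using HB HG by (auto simp: sets_restrict_space_iff Int_absorb2)
  have emeasure: "emeasure (restrict_space \<nu> H) A = emeasure \<nu> A" if "A \<subseteq> H" for A
    using HB HG that by (intro emeasure_restrict_space) (auto simp: Int_absorb2)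
  have "emeasure \<nu> H \<noteq> 0"
    using open_pos[OF H(2)] subgroup.one_closed[OF H(1)] by (metis empty_iff less_irrefl)
  moreover have "emeasure \<nu> (g <# A) = emeasure \<nu> A" "g <# A \<subseteq> H" if "g \<in> H" "A \<in> sets B" "A \<subseteq> H" for g A
    using that HG left_invariant[of g A] subgroup.m_closed[OF H(1)] by (auto simp: l_coset_def)
  moreover have "emeasure \<nu> K < \<infinity>" "K \<subseteq> H" if "compactin (subtopology T H) K" for K
    using that compact_finite[of K] by (auto simp: compactin_subtopology)
  ultimately have "left_haar_measure (G\<lparr>carrier := H\<rparr>) (subtopology T H) (restrict_space \<nu> H)"
    unfolding left_haar_measure_def
    by (simp add: sets sets_borel_on_open_subtopology[OF H(2)] emeasure)
  then show ?thesis by unfold_locales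
qed

section \<open>Transfer of strong ergodicity between the group and an open subgroup\<close>

locale open_subgroup_haar = haar_prob G T \<mu> for G :: "('a, 'b) monoid_scheme" (structure) and T \<mu> +
  fixes H \<Gamma> :: "'a set" and \<mu>\<^sub>1 :: "'a measure"
  assumes H: "subgroup H G" "openin T H"
    and \<Gamma>: "subgroup \<Gamma> G" "countable \<Gamma>" "T closure_of \<Gamma> = topspace T"
    and \<mu>\<^sub>1: "haar_probability (G\<lparr>carrier := H\<rparr>) (subtopology T H) \<mu>\<^sub>1"
begin

sublocale H: haar_prob "G\<lparr>carrier := H\<rparr>" "subtopology T H" \<mu>\<^sub>1
  using lcsc_open_subgroup[OF H] \<mu>\<^sub>1 by (simp add: haar_prob_def haar_prob_axioms_def)

lemma H_subset: "H \<subseteq> carrier G"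
  using H(1) by (rule subgroup.subset)

lemma H_borel: "H \<in> sets B"
  using H(2) by (rule openin_imp_borel_on)

lemma \<Gamma>_carrier: "g \<in> \<Gamma> \<Longrightarrow> g \<in> carrier G"
  using \<Gamma>(1) by (rule subgroup.mem_carrier)

lemma sets_subgroup: "sets H.B = {A \<in> sets B. A \<subseteq> H}"
  using H(2) by (rule sets_borel_on_open_subtopology)

text \<open>Uniqueness on \<open>H\<close> compares the Haar measure behind
  \<open>\<mu>\<^sub>1\<close> with the restriction of the one behind \<open>\<mu>\<close>.\<close>

lemma null_sets_subgroup: "null_sets \<mu>\<^sub>1 = {A \<in> null_sets \<mu>. A \<subseteq> H}"
proof -
  obtain \<nu> where \<nu>: "left_haar G T \<nu>" "null_sets \<mu> = null_sets \<nu>" by (rule haar_measure)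
  obtain \<nu>\<^sub>1 where \<nu>\<^sub>1: "left_haar (G\<lparr>carrier := H\<rparr>) (subtopology T H) \<nu>\<^sub>1" "null_sets \<mu>\<^sub>1 = null_sets \<nu>\<^sub>1"
    by (rule H.haar_measure)
  interpret \<nu>: left_haar G T \<nu> by fact
  have "null_sets \<nu>\<^sub>1 = null_sets (restrict_space \<nu> H)"
    using \<nu>\<^sub>1(1) \<nu>.left_haar_open_subgroup[OF H] by (rule H.null_sets_haar_unique)
  also have "\<dots> = {A \<in> null_sets \<nu>. A \<subseteq> H}"
    using H_borel H_subset
    by (auto simp: null_sets_def sets_restrict_space_iff Int_absorb2 emeasure_restrict_space)
  finally show ?thesis using \<nu>(2) \<nu>\<^sub>1(2) by simp
qed

lemma tendsto_subgroup_iff: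
  assumes A: "\<And>n. A n \<in> sets B" "\<And>n. A n \<subseteq> H"
  shows "(\<lambda>n. measure \<mu>\<^sub>1 (A n)) \<longlonglongrightarrow> 0 \<longleftrightarrow> (\<lambda>n. measure \<mu> (A n)) \<longlonglongrightarrow> 0"
proof -
  let ?N = "restrict_space \<mu> H"
  have fin: "finite_measure ?N" using H_borel H_subset
    by (intro finite_measure_restrict_space finite_measure_axioms) (auto simp: Int_absorb2)
  have sets: "sets ?N = sets \<mu>\<^sub>1"
    using H_borel H_subset by (auto simp: sets_restrict_space_iff Int_absorb2 sets_subgroup)
  have null: "null_sets ?N = null_sets \<mu>\<^sub>1"
    unfolding null_sets_subgroup using H_borel H_subset
    by (auto simp: null_sets_def sets_restrict_space_iff Int_absorb2 emeasure_restrict_space)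
  have "measure ?N (A n) = measure \<mu> (A n)" for n
    using A H_borel H_subset by (intro measure_restrict_space) (auto simp: Int_absorb2)
  moreover have "A n \<in> sets ?N" "A n \<in> sets \<mu>\<^sub>1" for n
    using A by (auto simp: sets sets_subgroup)
  ultimately show ?thesis
    using tendsto_measure_absolutely_continuous[OF fin H.finite_measure_axioms _ _ , of A]
      tendsto_measure_absolutely_continuous[OF H.finite_measure_axioms fin _ _, of A] sets null by auto
qed

text \<open>Density makes \<open>\<Gamma>\<close> meet every coset of \<open>H\<close>, so a section of \<open>G \<rightarrow> G/H\<close> can be chosen in \<open>\<Gamma>\<close>.\<close>

lemma coset_section:
  obtains s where "\<And>x. x \<in> carrier G \<Longrightarrow> s x \<in> \<Gamma>" "\<And>x. x \<in> carrier G \<Longrightarrow> inv (s x) \<otimes> x \<in> H"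
    "\<And>x y. \<lbrakk>x \<in> carrier G; y \<in> carrier G; inv x \<otimes> y \<in> H\<rbrakk> \<Longrightarrow> s x = s y"
    "\<And>x. x \<in> H \<Longrightarrow> s x = \<one>"
proof -
  \<comment> \<open>Choosing per coset makes the section constant on cosets. The value
    \<open>\<one>\<close> on \<open>H\<close> ensures that an extended set meets \<open>H\<close> in
    the original set.\<close>
  define f where "f C = (if C = H then \<one> else SOME g. g \<in> \<Gamma> \<inter> C)" for C
  define s where "s x = f (x <# H)" for x
  have s: "s x \<in> \<Gamma> \<inter> (x <# H)" if "x \<in> carrier G" for x
  proof (cases "x <# H = H")
    case True
    then show ?thesis
      using subgroup.one_closed[OF H(1)] subgroup.one_closed[OF \<Gamma>(1)] by (simp add: s_def f_def)
  next
    case False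
    have "openin T (x <# H)" using H(2) that by (rule openin_l_coset)
    moreover have "x <# H \<noteq> {}" using subgroup.one_closed[OF H(1)] by (auto simp: l_coset_def)
    ultimately have "\<exists>g. g \<in> \<Gamma> \<inter> (x <# H)"
      using \<Gamma>(3) unfolding dense_intersects_open by blast
    then have "(SOME g. g \<in> \<Gamma> \<inter> (x <# H)) \<in> \<Gamma> \<inter> (x <# H)" by (rule someI_ex)
    with False show ?thesis by (simp add: s_def f_def)
  qed
  show ?thesis
  proof
    show "s x \<in> \<Gamma>" if "x \<in> carrier G" for x using s[OF that] by blast
    show "inv (s x) \<otimes> x \<in> H" if x: "x \<in> carrier G" for x
    proof -
      have "inv x \<otimes> s x \<in> H" "s x \<in> carrier G"
        using s[OF x] x H_subset \<Gamma>_carrier by (auto simp: l_coset_eq)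
      then show ?thesis
        using subgroup.m_inv_closed[OF H(1), of "inv x \<otimes> s x"] x by (simp add: inv_mult_group)
    qed
    show "s x = s y" if "x \<in> carrier G" "y \<in> carrier G" "inv x \<otimes> y \<in> H" for x y
      using l_repr_independence[OF _ that(1) H(1), of y] that H_subset by (simp add: s_def l_coset_eq)
    show "s x = \<one>" if "x \<in> H" for x
      using subgroup_mult_id coset_join3[OF _ H(1) that] that H_subset by (auto simp: s_def f_def)
  qed
qed

text \<open>By \<open>coset_section\<close> the cosets of elements of the countable group
  \<open>\<Gamma>\<close> cover everything, so \<open>tendsto_measure_cover\<close> applies.\<close>

lemma tendsto_cosets:
  assumes D: "\<And>n. D n \<in> sets B" and lim: "\<And>g. g \<in> \<Gamma> \<Longrightarrow> (\<lambda>n. measure \<mu> (D n \<inter> (g <# H))) \<longlonglongrightarrow> 0"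
  shows "(\<lambda>n. measure \<mu> (D n)) \<longlonglongrightarrow> 0"
proof -
  obtain s where s: "\<And>x. x \<in> carrier G \<Longrightarrow> s x \<in> \<Gamma>" "\<And>x. x \<in> carrier G \<Longrightarrow> inv (s x) \<otimes> x \<in> H"
    by (rule coset_section) blast
  define e where "e = from_nat_into \<Gamma>"
  have ne: "\<Gamma> \<noteq> {}" using subgroup.one_closed[OF \<Gamma>(1)] by blast
  have e: "e k \<in> \<Gamma>" for k using from_nat_into[OF ne] by (simp add: e_def)
  have "\<exists>k. x \<in> e k <# H" if x: "x \<in> carrier G" for x
  proof -
    obtain k where "s x = e k" unfolding e_def using from_nat_into_surj[OF \<Gamma>(2) s(1)[OF x]] by metis
    then have "x \<in> e k <# H"
      using s(2)[OF x] x \<Gamma>_carrier[OF e] H_subset by (simp add: l_coset_eq)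
    then show ?thesis ..
  qed
  then have cover: "AE x in \<mu>. \<exists>k. x \<in> e k <# H" by (intro AE_I2) simp
  have P: "e k <# H \<in> sets \<mu>" for k using l_coset_borel[OF H_borel \<Gamma>_carrier[OF e]] by simp
  have D': "D n \<in> sets \<mu>" for n using D by simp
  show ?thesis
    by (rule tendsto_measure_cover[OF finite_measure_axioms D' P cover lim[OF e]])
qed

lemma subgroup_Int: "subgroup (\<Gamma> \<inter> H) (G\<lparr>carrier := H\<rparr>)"
proof -
  have "subgroup (\<Gamma> \<inter> H) G" using \<Gamma>(1) H(1) by (rule subgroups_Inter_pair)
  then show ?thesis using H(1) by (intro subgroup_incl) auto
qed

lemma strongly_ergodic_iff:
  "strongly_ergodic_action (G\<lparr>carrier := \<Gamma>\<rparr>) (left_translation G) \<mu> \<longleftrightarrow>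
   strongly_ergodic_action (G\<lparr>carrier := \<Gamma> \<inter> H\<rparr>) (left_translation (G\<lparr>carrier := H\<rparr>)) \<mu>\<^sub>1"
  (is "?E \<longleftrightarrow> ?E\<^sub>1")
proof -
  have E: "?E \<longleftrightarrow> (\<forall>A. (\<forall>n. A n \<in> sets B) \<longrightarrow>
      (\<forall>g\<in>\<Gamma>. (\<lambda>n. measure \<mu> (sym_diff (A n) (g <# A n))) \<longlonglongrightarrow> 0) \<longrightarrow>
      (\<exists>S. (\<lambda>n. measure \<mu> (if n \<in> S then carrier G - A n else A n)) \<longlonglongrightarrow> 0))"
    unfolding strongly_ergodic_action_def strongly_ergodic_def almost_invariant_sequence_iff[OF \<Gamma>(1,2)]
    using trivial_sequence_iff[OF prob_space_axioms, unfolded space_eq] by (simp add: imp_conjL)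
  have cnt: "countable (\<Gamma> \<inter> H)" using \<Gamma>(2) by auto
  have coset_H: "g <# A \<in> sets B" "g <# A \<subseteq> H" if "g \<in> H" "A \<in> sets B" "A \<subseteq> H" for g A
    using that l_coset_borel H_subset subgroup.m_closed[OF H(1)] by (auto simp: l_coset_def)
  have space_H: "space \<mu>\<^sub>1 = H" by simp
  have "?E\<^sub>1 \<longleftrightarrow> (\<forall>A. (\<forall>n. A n \<in> sets B \<and> A n \<subseteq> H) \<longrightarrow>
      (\<forall>g\<in>\<Gamma> \<inter> H. (\<lambda>n. measure \<mu>\<^sub>1 (sym_diff (A n) (g <# A n))) \<longlonglongrightarrow> 0) \<longrightarrow>
      (\<exists>S. (\<lambda>n. measure \<mu>\<^sub>1 (if n \<in> S then H - A n else A n)) \<longlonglongrightarrow> 0))"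
    using H.almost_invariant_sequence_iff[OF subgroup_Int cnt] trivial_sequence_iff[OF H.prob_space_axioms, unfolded space_H]
    unfolding strongly_ergodic_action_def strongly_ergodic_def
    by (simp add: sets_subgroup imp_conjL)
  \<comment> \<open>With every condition phrased as a limit 0 of subsets of \<open>H\<close>,
    \<open>\<mu>\<^sub>1\<close> can be replaced by \<open>\<mu>\<close>.\<close>
  also have "\<dots> \<longleftrightarrow> (\<forall>A. (\<forall>n. A n \<in> sets B \<and> A n \<subseteq> H) \<longrightarrow>
      (\<forall>g\<in>\<Gamma> \<inter> H. (\<lambda>n. measure \<mu> (sym_diff (A n) (g <# A n))) \<longlonglongrightarrow> 0) \<longrightarrow>
      (\<exists>S. (\<lambda>n. measure \<mu> (if n \<in> S then H - A n else A n)) \<longlonglongrightarrow> 0))"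
    (is "(\<forall>A. ?B A \<longrightarrow> ?I\<^sub>1 A \<longrightarrow> ?T\<^sub>1 A) \<longleftrightarrow> (\<forall>A. ?B A \<longrightarrow> ?I A \<longrightarrow> ?T A)")
  proof -
    have "?I\<^sub>1 A \<longleftrightarrow> ?I A" if "?B A" for A
    proof -
      have "sym_diff (A n) (g <# A n) \<in> sets B" "sym_diff (A n) (g <# A n) \<subseteq> H"
        if "g \<in> \<Gamma> \<inter> H" for g n
        using that \<open>?B A\<close> coset_H[of g "A n"] by (auto intro!: sets.Un sets.Diff)
      then show ?thesis by (intro ball_cong refl tendsto_subgroup_iff) auto
    qed
    moreover have "?T\<^sub>1 A \<longleftrightarrow> ?T A" if "?B A" for A
      using that H_borel by (intro ex_cong1 tendsto_subgroup_iff) auto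
    ultimately show ?thesis by (intro all_cong1) blast
  qed
  finally have E\<^sub>1: "?E\<^sub>1 \<longleftrightarrow> \<dots>" .
  obtain s where s: "\<And>x. x \<in> carrier G \<Longrightarrow> s x \<in> \<Gamma>" "\<And>x. x \<in> carrier G \<Longrightarrow> inv (s x) \<otimes> x \<in> H"
    "\<And>x y. \<lbrakk>x \<in> carrier G; y \<in> carrier G; inv x \<otimes> y \<in> H\<rbrakk> \<Longrightarrow> s x = s y"
    "\<And>x. x \<in> H \<Longrightarrow> s x = \<one>"
    by (rule coset_section) blast
  show ?thesis
  proof
    assume ?E
    show ?E\<^sub>1
      unfolding E\<^sub>1
    proof (intro allI impI)
      fix A :: "nat \<Rightarrow> 'a set"
      assume "\<forall>n. A n \<in> sets B \<and> A n \<subseteq> H"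
      then have A: "\<And>n. A n \<in> sets B" "\<And>n. A n \<subseteq> H" by auto
      assume inv: "\<forall>g\<in>\<Gamma> \<inter> H. (\<lambda>n. measure \<mu> (sym_diff (A n) (g <# A n))) \<longlonglongrightarrow> 0"
      \<comment> \<open>The induced set: a copy of \<open>A n\<close> in each coset, moved there by
        the chosen representative.\<close>
      define C where "C n = {x \<in> carrier G. inv (s x) \<otimes> x \<in> A n}" for n
      have sc: "s x \<in> carrier G" if "x \<in> carrier G" for x
        using s(1)[OF that] by (rule \<Gamma>_carrier)
      have C_union: "C n = (\<Union>g\<in>s ` carrier G. g <# A n)" for n
      proof (intro equalityI subsetI)
        fix x assume "x \<in> C n"
        then have "x \<in> carrier G" "x \<in> s x <# A n"
          using sc A H_subset by (auto simp: C_def l_coset_eq borel_subset)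
        then show "x \<in> (\<Union>g\<in>s ` carrier G. g <# A n)" by blast
      next
        fix x assume "x \<in> (\<Union>g\<in>s ` carrier G. g <# A n)"
        then obtain y where y: "y \<in> carrier G" "x \<in> s y <# A n" by blast
        then have x: "x \<in> carrier G" "inv (s y) \<otimes> x \<in> A n"
          using sc A by (auto simp: l_coset_eq borel_subset)
        have "s (s y) = s y" using s(2,3) y(1) sc by blast
        moreover have "s (s y) = s x" using s(3) x y(1) sc A(2) by blast
        ultimately show "x \<in> C n" using x by (simp add: C_def)
      qed
      have C: "C n \<in> sets B" for n
        unfolding C_union using A(1) sc countable_subset[OF _ \<Gamma>(2), of "s ` carrier G"] s(1)
        by (intro sets.countable_UN'' l_coset_borel) auto
      have "(\<lambda>n. measure \<mu> (sym_diff (C n) (g <# C n))) \<longlonglongrightarrow> 0" if g: "g \<in> \<Gamma>" for g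
      proof (rule tendsto_cosets)
        have gc: "g \<in> carrier G" using g by (rule \<Gamma>_carrier)
        show "sym_diff (C n) (g <# C n) \<in> sets B" for n
          using C l_coset_borel[OF C gc] by auto
        fix y assume "y \<in> \<Gamma>"
        then have y: "y \<in> carrier G" by (rule \<Gamma>_carrier)
        define t u where "t = s y" and "u = s (inv g \<otimes> y)"
        have tu: "t \<in> \<Gamma>" "u \<in> \<Gamma>" "t \<in> carrier G" "u \<in> carrier G"
          using s(1) y gc sc by (auto simp: t_def u_def)
        \<comment> \<open>The cocycle of the induced action: \<open>g\<close> carries the coset of
          \<open>u\<close> to that of \<open>t\<close>, and in \<open>H\<close>-coordinates it acts
          as \<open>h\<close>. On the coset of \<open>y\<close>, \<open>C n\<close> is
          \<open>t <# A n\<close> and \<open>g <# C n\<close> is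
          \<open>t <# (h <# A n)\<close>.\<close>
        define h where "h = inv t \<otimes> (g \<otimes> u)"
        have "h \<in> \<Gamma>"
          unfolding h_def using tu g by (intro subgroup.m_closed[OF \<Gamma>(1)] subgroup.m_inv_closed[OF \<Gamma>(1)])
        moreover have "h \<in> H"
        proof -
          have "inv t \<otimes> y \<in> H" "inv (inv u \<otimes> (inv g \<otimes> y)) \<in> H"
            using s(2) y gc subgroup.m_inv_closed[OF H(1)] by (auto simp: t_def u_def)
          then have "(inv t \<otimes> y) \<otimes> inv (inv u \<otimes> (inv g \<otimes> y)) \<in> H"
            by (rule subgroup.m_closed[OF H(1)])
          then show ?thesis
            using y gc tu by (simp add: h_def inv_mult_group m_assoc inv_mult_cancel)
        qed
        ultimately have h: "h \<in> \<Gamma> \<inter> H" "h \<in> carrier G" using \<Gamma>_carrier by auto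
        define S where "S n = sym_diff (A n) (h <# A n)" for n
        have S: "S n \<in> sets B" for n
          unfolding S_def using A(1) l_coset_borel[OF A(1) h(2)] by auto
        have "(\<lambda>n. measure \<mu> (t <# S n)) \<longlonglongrightarrow> 0"
          using inv h(1) by (intro tendsto_l_coset tu S) (auto simp: S_def)
        then show "(\<lambda>n. measure \<mu> (sym_diff (C n) (g <# C n) \<inter> (y <# H))) \<longlonglongrightarrow> 0"
        proof (rule tendsto_subset[rotated 2])
          fix n
          show "t <# S n \<in> sets B" using S tu(3) by (rule l_coset_borel)
          show "sym_diff (C n) (g <# C n) \<inter> (y <# H) \<subseteq> t <# S n"
          proof
            fix x assume x: "x \<in> sym_diff (C n) (g <# C n) \<inter> (y <# H)"
            then have xc: "x \<in> carrier G" and yx: "inv y \<otimes> x \<in> H"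
              using y H_subset by (auto simp: l_coset_eq)
            have sx: "s x = t" using s(3)[OF y xc yx] by (simp add: t_def)
            have "s (inv g \<otimes> x) = u"
              using s(3)[of "inv g \<otimes> y" "inv g \<otimes> x"] y xc gc yx
              by (simp add: u_def inv_mult_group m_assoc inv_mult_cancel)
            then have "x \<in> g <# C n \<longleftrightarrow> inv u \<otimes> (inv g \<otimes> x) \<in> A n"
              using xc gc borel_subset[OF C] by (simp add: l_coset_eq) (simp add: C_def)
            also have "inv u \<otimes> (inv g \<otimes> x) = inv h \<otimes> (inv t \<otimes> x)"
              using xc gc tu by (simp add: h_def inv_mult_group m_assoc inv_mult_cancel)
            also have "\<dots> \<in> A n \<longleftrightarrow> inv t \<otimes> x \<in> h <# A n"
              using xc tu h(2) borel_subset[OF A(1)] by (simp add: l_coset_eq)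
            finally have "x \<in> g <# C n \<longleftrightarrow> inv t \<otimes> x \<in> h <# A n" .
            moreover have "x \<in> C n \<longleftrightarrow> inv t \<otimes> x \<in> A n"
              using xc sx by (simp add: C_def)
            ultimately have "inv t \<otimes> x \<in> S n" using x by (auto simp: S_def)
            then show "x \<in> t <# S n" using xc tu(3) borel_subset[OF S] by (simp add: l_coset_eq)
          qed
        qed
      qed
      then obtain S where S: "(\<lambda>n. measure \<mu> (if n \<in> S then carrier G - C n else C n)) \<longlonglongrightarrow> 0"
        using \<open>?E\<close> C unfolding E by blast
      have CH: "C n \<inter> H = A n" for n
        using s(4) A(2)[of n] H_subset by (auto simp: C_def subset_iff)
      have "(\<lambda>n. measure \<mu> (if n \<in> S then H - A n else A n)) \<longlonglongrightarrow> 0"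
      proof (rule tendsto_subset[OF _ _ S])
        fix n
        show "(if n \<in> S then carrier G - C n else C n) \<in> sets B"
          using C[of n] sets.compl_sets[OF C[of n]] by simp
        show "(if n \<in> S then H - A n else A n) \<subseteq> (if n \<in> S then carrier G - C n else C n)"
          using CH[of n] H_subset by auto
      qed
      then show "\<exists>S. (\<lambda>n. measure \<mu> (if n \<in> S then H - A n else A n)) \<longlonglongrightarrow> 0" ..
    qed
  next
    assume ?E\<^sub>1
    show ?E
      unfolding E
    proof (intro allI impI)
      fix A :: "nat \<Rightarrow> 'a set"
      assume "\<forall>n. A n \<in> sets B"
      then have A: "\<And>n. A n \<in> sets B" by auto
      assume inv: "\<forall>g\<in>\<Gamma>. (\<lambda>n. measure \<mu> (sym_diff (A n) (g <# A n))) \<longlonglongrightarrow> 0"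
      have "(\<lambda>n. measure \<mu> (sym_diff (A n \<inter> H) (h <# (A n \<inter> H)))) \<longlonglongrightarrow> 0" if h: "h \<in> \<Gamma> \<inter> H" for h
      proof (rule tendsto_subset)
        have hc: "h \<in> carrier G" using h \<Gamma>_carrier by blast
        show "(\<lambda>n. measure \<mu> (sym_diff (A n) (h <# A n))) \<longlonglongrightarrow> 0" using inv h by blast
        fix n
        show "sym_diff (A n) (h <# A n) \<in> sets B" using A[of n] l_coset_borel[OF A[of n] hc] by auto
        have "h <# (A n \<inter> H) = (h <# A n) \<inter> H"
        proof -
          have "h <# H = H" using coset_join3[OF hc H(1)] h by blast
          then show ?thesis
            using hc borel_subset[OF A] H_subset by (auto simp: l_coset_eq subset_iff)
        qed
        then show "sym_diff (A n \<inter> H) (h <# (A n \<inter> H)) \<subseteq> sym_diff (A n) (h <# A n)" by auto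
      qed
      then obtain S where S: "(\<lambda>n. measure \<mu> (if n \<in> S then H - A n \<inter> H else A n \<inter> H)) \<longlonglongrightarrow> 0"
        using \<open>?E\<^sub>1\<close>[unfolded E\<^sub>1, rule_format, of "\<lambda>n. A n \<inter> H"] A H_borel by auto
      \<comment> \<open>The complements found to be right on \<open>H\<close> are imposed on the
        whole group.\<close>
      define D where "D n = (if n \<in> S then carrier G - A n else A n)" for n
      have D: "D n \<in> sets B" for n
        using A[of n] sets.compl_sets[OF A[of n]] by (simp add: D_def)
      have "(\<lambda>n. measure \<mu> (D n)) \<longlonglongrightarrow> 0"
      proof (rule tendsto_cosets[OF D])
        fix g assume g: "g \<in> \<Gamma>"
        then have gc: "g \<in> carrier G" by (rule \<Gamma>_carrier)
        have DH: "D n \<inter> H = (if n \<in> S then H - A n \<inter> H else A n \<inter> H)" for n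
          using H_subset by (auto simp: D_def)
        have DHB: "D n \<inter> H \<in> sets B" for n using D H_borel by (rule sets.Int)
        have lim1: "(\<lambda>n. measure \<mu> (g <# (D n \<inter> H))) \<longlonglongrightarrow> 0"
          using S by (intro tendsto_l_coset gc DHB) (simp add: DH)
        have lim2: "(\<lambda>n. measure \<mu> (sym_diff (A n) (g <# A n))) \<longlonglongrightarrow> 0" using inv g by blast
        have sd: "sym_diff (A n) (g <# A n) \<in> sets B" for n
          using A[of n] l_coset_borel[OF A[of n] gc] by auto
        have "(\<lambda>n. measure \<mu> (g <# (D n \<inter> H)) + measure \<mu> (sym_diff (A n) (g <# A n))) \<longlonglongrightarrow> 0"
          using tendsto_add[OF lim1 lim2] by simp
        moreover have "measure \<mu> (D n \<inter> (g <# H)) \<le>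
            measure \<mu> (g <# (D n \<inter> H)) + measure \<mu> (sym_diff (A n) (g <# A n))" for n
        proof -
          \<comment> \<open>Complementing a set and its translate leaves their symmetric difference
            unchanged, so almost invariance carries smallness from \<open>H\<close> to
            \<open>g <# H\<close> in both cases of \<open>D n\<close>.\<close>
          have "D n \<inter> (g <# H) \<subseteq> (g <# (D n \<inter> H)) \<union> sym_diff (A n) (g <# A n)"
            using gc borel_subset[OF A] borel_subset[OF D] H_subset
            by (auto simp: l_coset_eq subset_iff D_def)
          then have "measure \<mu> (D n \<inter> (g <# H)) \<le> measure \<mu> ((g <# (D n \<inter> H)) \<union> sym_diff (A n) (g <# A n))"
            using sd l_coset_borel[OF DHB gc] by (intro finite_measure_mono) (auto intro!: sets.Un)
          also have "\<dots> \<le> measure \<mu> (g <# (D n \<inter> H)) + measure \<mu> (sym_diff (A n) (g <# A n))"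
            using sd l_coset_borel[OF DHB gc] by (intro measure_Un_le) auto
          finally show ?thesis .
        qed
        ultimately show "(\<lambda>n. measure \<mu> (D n \<inter> (g <# H))) \<longlonglongrightarrow> 0"
          by (intro Lim_null_comparison[where f = "\<lambda>n. measure \<mu> (D n \<inter> (g <# H))"] always_eventually)
            (simp_all only: real_norm_def abs_of_nonneg measure_nonneg simp_thms)
      qed
      then show "\<exists>S. (\<lambda>n. measure \<mu> (if n \<in> S then carrier G - A n else A n)) \<longlonglongrightarrow> 0"
        unfolding D_def ..
    qed
  qed
qed

end

theorem theorem1p3:
  fixes G :: "('a, 'b) monoid_scheme" and T :: "'a topology"
    and \<Gamma> :: "'a set" and \<mu> \<mu>\<^sub>1 :: "'a measure"
  assumes "lcsc_group G T"
    and "almost_unimodular G T"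
    and "subgroup \<Gamma> G"
    and "countable \<Gamma>"
    and "T closure_of \<Gamma> = topspace T"
    and "haar_probability G T \<mu>"
    and "haar_probability (G\<lparr>carrier := modular_kernel G T\<rparr>)
           (subtopology T (modular_kernel G T)) \<mu>\<^sub>1"
  shows "strongly_ergodic_action (G\<lparr>carrier := \<Gamma>\<rparr>) (left_translation G) \<mu> \<longleftrightarrow>
         strongly_ergodic_action (G\<lparr>carrier := \<Gamma> \<inter> modular_kernel G T\<rparr>)
           (left_translation (G\<lparr>carrier := modular_kernel G T\<rparr>)) \<mu>\<^sub>1"
proof -
  have "group G" using assms(1) by (simp add: lcsc_group_def topological_group_def)
  then interpret haar_prob G T \<mu>
    using assms(1,6)
    by (simp add: haar_prob_def haar_prob_axioms_def lcsc_topological_group_def lcsc_topological_group_axioms_def)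
  \<comment> \<open>The Haar measure is the witness contained in
    \<open>haar_probability\<close>.\<close>
  obtain \<nu> where "left_haar G T \<nu>" by (rule haar_measure)
  then have "subgroup (modular_kernel G T) G" by (rule subgroup_modular_kernel)
  then interpret open_subgroup_haar G T \<mu> "modular_kernel G T" \<Gamma> \<mu>\<^sub>1
    using assms(2-5,7) haar_prob_axioms
    by (simp add: open_subgroup_haar_def open_subgroup_haar_axioms_def almost_unimodular_def)
  show ?thesis by (rule strongly_ergodic_iff)
qed

end
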